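(* Let $n\ge 2$. There is a split short exact sequence $$1\longrightarrow\mathbb{Z}^{n(n-1)/2}\longrightarrow VT_n/\Gamma_2(PVT_n)\stackrel{\overline{\pi}}{\longrightarrow}S_n\longrightarrow 1$$ and the middle group is a crystallographic group.
   Context: A group $\Pi$ is crystallographic if there are $m\in\mathbb{N}$ and a short exact sequence $0\to\mathbb{Z}^m\to\Pi\to\Phi\to1$ with $\Phi$ finite such that the representation $\Phi\to\mathrm{Aut}(\mathbb{Z}^m)$ induced by conjugation is faithful. $\Gamma_2(H)=[H,H]$. The virtual twin group $VT_n$ is the group with generators $\sigma_i,\rho_i$ ($1\le i\le n-1$) and relations: $\sigma_i^2=1$, $\rho_i^2=1$ for $1\le i\le n-1$; $\sigma_i\sigma_j=\sigma_j\sigma_i$, $\rho_i\rho_j=\rho_j\rho_i$, $\rho_i\sigma_j=\sigma_j\rho_i$ for $|i-j|\ge 2$; $\rho_i\rho_{i+1}\rho_i=\rho_{i+1}\rho_i\rho_{i+1}$ and $\rho_i\rho_{i+1}\sigma_i=\sigma_{i+1}\rho_i\rho_{i+1}$ for $1\le i\le n-2$. The pure virtual twin group $PVT_n$ is the kernel of $\pi\colon VT_n\to S_n$, $\sigma_i,\rho_i\mapsto(i,i+1)$, and $\overline{\pi}$ is the map induced by $\pi$. *)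

theory Defs
  imports "HOL-Algebra.Generated_Groups" "HOL-Algebra.Sym_Groups" "HOL-Algebra.Bij"
    "HOL-Algebra.Product_Groups" "HOL-Algebra.Elementary_Groups"
    "HOL-Combinatorics.Transposition"
begin

section \<open>Groups given by generators and relations\<close>

text \<open>The letter \<open>(s, True)\<close> stands for the generator \<open>s\<close> and \<open>(s, False)\<close> for its formal inverse.\<close>

type_synonym 's gword = "('s \<times> bool) list"

definition gwords :: "'s set \<Rightarrow> 's gword set" where
  "gwords S = lists (S \<times> UNIV)"

text \<open>A relation \<open>u = v\<close> is a pair \<open>(u, v)\<close> of words. Two words over \<open>S\<close> represent the same element
  of the group presented by \<open>S\<close> and \<open>R\<close> iff they are related by the following congruence.\<close>

inductive word_eq :: "'s set \<Rightarrow> ('s gword \<times> 's gword) set \<Rightarrow> 's gword \<Rightarrow> 's gword \<Rightarrow> bool"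
  for S R where
  relation: "(u, v) \<in> R \<Longrightarrow> u \<in> gwords S \<Longrightarrow> v \<in> gwords S \<Longrightarrow> word_eq S R u v"
| cancel: "s \<in> S \<Longrightarrow> word_eq S R [(s, b), (s, \<not> b)] []"
| refl: "u \<in> gwords S \<Longrightarrow> word_eq S R u u"
| sym: "word_eq S R u v \<Longrightarrow> word_eq S R v u"
| trans: "word_eq S R u v \<Longrightarrow> word_eq S R v w \<Longrightarrow> word_eq S R u w"
| append: "word_eq S R u u' \<Longrightarrow> word_eq S R v v' \<Longrightarrow> word_eq S R (u @ v) (u' @ v')"

definition word_class :: "'s set \<Rightarrow> ('s gword \<times> 's gword) set \<Rightarrow> 's gword \<Rightarrow> 's gword set" where
  "word_class S R u = {v. word_eq S R u v}"

definition presented_group ::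
  "'s set \<Rightarrow> ('s gword \<times> 's gword) set \<Rightarrow> 's gword set monoid" where
  "presented_group S R =
     \<lparr>carrier = word_class S R ` gwords S,
      monoid.mult = (\<lambda>A B. \<Union>u\<in>A. \<Union>v\<in>B. word_class S R (u @ v)),
      one = word_class S R []\<rparr>"

definition word_value :: "('b, 'c) monoid_scheme \<Rightarrow> ('s \<Rightarrow> 'b) \<Rightarrow> 's gword \<Rightarrow> 'b" where
  "word_value H f w =
     foldr (\<lambda>(s, b) x. (if b then f s else inv\<^bsub>H\<^esub> (f s)) \<otimes>\<^bsub>H\<^esub> x) w \<one>\<^bsub>H\<^esub>"

text \<open>The homomorphism out of a presented group determined by the images \<open>f s\<close> of the generators;
  it is well defined when \<open>f\<close> respects the relations, see \<open>presented_hom_class\<close> below.\<close>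

definition presented_hom ::
  "('b, 'c) monoid_scheme \<Rightarrow> ('s \<Rightarrow> 'b) \<Rightarrow> 's gword set \<Rightarrow> 'b" where
  "presented_hom H f A = the_elem (word_value H f ` A)"

lemma gwords_simps [simp]:
  "[] \<in> gwords S"
  "(x # w) \<in> gwords S \<longleftrightarrow> fst x \<in> S \<and> w \<in> gwords S"
  "u @ w \<in> gwords S \<longleftrightarrow> u \<in> gwords S \<and> w \<in> gwords S"
  by (cases x; auto simp: gwords_def)+

lemma word_eq_gwords: "word_eq S R u v \<Longrightarrow> u \<in> gwords S \<and> v \<in> gwords S"
  by (induction rule: word_eq.induct) auto

lemma word_class_self: "u \<in> gwords S \<Longrightarrow> u \<in> word_class S R u"
  by (simp add: word_class_def word_eq.refl)

lemma word_class_eq: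
  assumes "word_eq S R u v"
  shows "word_class S R u = word_class S R v"
proof (rule Set.set_eqI)
  fix w
  show "w \<in> word_class S R u \<longleftrightarrow> w \<in> word_class S R v"
    using word_eq.trans[OF assms, of w] word_eq.trans[OF word_eq.sym[OF assms], of w]
    unfolding word_class_def mem_Collect_eq by argo
qed

lemma presented_mult:
  assumes "u \<in> gwords S" "v \<in> gwords S"
  shows "word_class S R u \<otimes>\<^bsub>presented_group S R\<^esub> word_class S R v = word_class S R (u @ v)"
proof -
  have eq: "word_class S R (u' @ v') = word_class S R (u @ v)"
    if u': "u' \<in> word_class S R u" and v': "v' \<in> word_class S R v" for u' v'
  proof -
    have "word_eq S R u u'" "word_eq S R v v'"
      using u' v' by (simp_all only: word_class_def mem_Collect_eq)
    then show ?thesis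
      by (rule word_class_eq[OF word_eq.append, symmetric])
  qed
  have "word_class S R u \<otimes>\<^bsub>presented_group S R\<^esub> word_class S R v =
      (\<Union>u'\<in>word_class S R u. \<Union>v'\<in>word_class S R v. word_class S R (u' @ v'))"
    by (simp only: presented_group_def monoid.simps)
  also have "\<dots> = (\<Union>u'\<in>word_class S R u. \<Union>v'\<in>word_class S R v. word_class S R (u @ v))"
    by (intro SUP_cong HOL.refl eq)
  also have "\<dots> = word_class S R (u @ v)"
    using word_class_self[OF assms(1), of R] word_class_self[OF assms(2), of R] by blast
  finally show ?thesis .
qed

lemma inverse_word:
  "u \<in> gwords S \<Longrightarrow>
     rev (map (\<lambda>(s, b). (s, \<not> b)) u) \<in> gwords S \<and>
     word_eq S R (rev (map (\<lambda>(s, b). (s, \<not> b)) u) @ u) []"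
proof (induction u)
  case Nil
  then show ?case by (simp add: word_eq.refl)
next
  case (Cons x u)
  obtain s b where x: "x = (s, b)" by (cases x)
  let ?r = "rev (map (\<lambda>(s, b). (s, \<not> b)) u)"
  have s: "s \<in> S" and u: "u \<in> gwords S" using Cons.prems x by auto
  have r: "?r \<in> gwords S" and e: "word_eq S R (?r @ u) []" using Cons.IH[OF u] by blast+
  have "word_eq S R [(s, \<not> b), (s, b)] []"
    using word_eq.cancel[OF s, of R "\<not> b"] by simp
  then have "word_eq S R (?r @ ([(s, \<not> b), (s, b)] @ u)) (?r @ ([] @ u))"
    by (intro word_eq.append word_eq.refl r u)
  from word_eq.trans[OF this] e have "word_eq S R (?r @ ([(s, \<not> b), (s, b)] @ u)) []"
    by simp
  then show ?case using x s r by simp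
qed

lemma group_presented_group: "group (presented_group S R)"
proof (rule groupI)
  have car: "carrier (presented_group S R) = word_class S R ` gwords S"
    and one: "\<one>\<^bsub>presented_group S R\<^esub> = word_class S R []"
    by (simp_all add: presented_group_def)
  show "\<one>\<^bsub>presented_group S R\<^esub> \<in> carrier (presented_group S R)"
    by (auto simp: car one)
  fix x y assume "x \<in> carrier (presented_group S R)" "y \<in> carrier (presented_group S R)"
  then show "x \<otimes>\<^bsub>presented_group S R\<^esub> y \<in> carrier (presented_group S R)"
    by (auto simp: car presented_mult)
next
  fix x y z
  assume "x \<in> carrier (presented_group S R)" "y \<in> carrier (presented_group S R)"
    "z \<in> carrier (presented_group S R)"
  then obtain u v w where "u \<in> gwords S" "v \<in> gwords S" "w \<in> gwords S"
    "x = word_class S R u" "y = word_class S R v" "z = word_class S R w"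
    by (auto simp: presented_group_def)
  then show "x \<otimes>\<^bsub>presented_group S R\<^esub> y \<otimes>\<^bsub>presented_group S R\<^esub> z =
      x \<otimes>\<^bsub>presented_group S R\<^esub> (y \<otimes>\<^bsub>presented_group S R\<^esub> z)"
    by (simp add: presented_mult)
next
  fix x assume "x \<in> carrier (presented_group S R)"
  then obtain u where u: "u \<in> gwords S" "x = word_class S R u"
    by (auto simp: presented_group_def)
  have one: "\<one>\<^bsub>presented_group S R\<^esub> = word_class S R []"
    by (simp add: presented_group_def)
  show "\<one>\<^bsub>presented_group S R\<^esub> \<otimes>\<^bsub>presented_group S R\<^esub> x = x"
    using u presented_mult[of "[]" S u R] by (simp add: one)
  have i: "rev (map (\<lambda>(s, b). (s, \<not> b)) u) \<in> gwords S"
    and e: "word_eq S R (rev (map (\<lambda>(s, b). (s, \<not> b)) u) @ u) []"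
    using inverse_word[OF u(1)] by auto
  show "\<exists>y\<in>carrier (presented_group S R).
      y \<otimes>\<^bsub>presented_group S R\<^esub> x = \<one>\<^bsub>presented_group S R\<^esub>"
  proof (rule bexI)
    show "word_class S R (rev (map (\<lambda>(s, b). (s, \<not> b)) u)) \<in> carrier (presented_group S R)"
      using i by (simp add: presented_group_def)
    show "word_class S R (rev (map (\<lambda>(s, b). (s, \<not> b)) u)) \<otimes>\<^bsub>presented_group S R\<^esub> x =
        \<one>\<^bsub>presented_group S R\<^esub>"
      using i u by (simp only: u(2) presented_mult one word_class_eq[OF e])
  qed
qed

locale presented_hom_data = H: group H
  for H :: "('b, 'c) monoid_scheme" (structure) and S :: "'s set" and R and f :: "'s \<Rightarrow> 'b" +
  assumes gen_closed: "s \<in> S \<Longrightarrow> f s \<in> carrier H"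
    and respects: "(u, v) \<in> R \<Longrightarrow> word_value H f u = word_value H f v"
begin

lemma word_value_closed: "u \<in> gwords S \<Longrightarrow> word_value H f u \<in> carrier H"
  by (induction u) (auto simp: word_value_def gen_closed)

lemma word_value_append:
  "u \<in> gwords S \<Longrightarrow> v \<in> gwords S \<Longrightarrow>
     word_value H f (u @ v) = word_value H f u \<otimes> word_value H f v"
proof (induction u)
  case Nil
  then show ?case using word_value_closed[of v] by (simp add: word_value_def)
next
  case (Cons x u)
  then show ?case
    using word_value_closed[of u] word_value_closed[of v]
    by (cases x) (auto simp: word_value_def gen_closed H.m_assoc)
qed

lemma word_value_cong: "word_eq S R u v \<Longrightarrow> word_value H f u = word_value H f v"
proof (induction rule: word_eq.induct)
  case (cancel s b)
  then show ?case by (auto simp: word_value_def gen_closed)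
next
  case (append u u' v v')
  then show ?case
    using word_eq_gwords[OF append.hyps(1)] word_eq_gwords[OF append.hyps(2)]
    by (simp add: word_value_append)
qed (auto simp: respects)

lemma presented_hom_class:
  assumes "u \<in> gwords S"
  shows "presented_hom H f (word_class S R u) = word_value H f u"
proof -
  have "word_value H f ` word_class S R u = {word_value H f u}"
    using word_class_self[OF assms] word_value_cong by (fastforce simp: word_class_def)
  then show ?thesis by (simp add: presented_hom_def)
qed

lemma presented_hom_hom: "presented_hom H f \<in> hom (presented_group S R) H"
proof (rule homI)
  fix x assume "x \<in> carrier (presented_group S R)"
  then show "presented_hom H f x \<in> carrier H"
    by (auto simp: presented_group_def presented_hom_class word_value_closed)
next
  fix x y assume "x \<in> carrier (presented_group S R)" "y \<in> carrier (presented_group S R)"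
  then obtain u v where "u \<in> gwords S" "v \<in> gwords S" "x = word_class S R u" "y = word_class S R v"
    by (auto simp: presented_group_def)
  then show "presented_hom H f (x \<otimes>\<^bsub>presented_group S R\<^esub> y) =
      presented_hom H f x \<otimes> presented_hom H f y"
    by (simp add: presented_mult presented_hom_class word_value_append)
qed

end

section \<open>Virtual twin groups\<close>

datatype vt_gen = Sig nat | Rho nat

definition VT_gens :: "nat \<Rightarrow> vt_gen set" where
  "VT_gens n = Sig ` {1..n-1} \<union> Rho ` {1..n-1}"

definition pos_word :: "'s list \<Rightarrow> 's gword" where
  "pos_word ss = map (\<lambda>s. (s, True)) ss"

inductive_set VT_rels :: "nat \<Rightarrow> (vt_gen gword \<times> vt_gen gword) set" for n where
  sig_sq: "i \<in> {1..n-1} \<Longrightarrow> (pos_word [Sig i, Sig i], []) \<in> VT_rels n"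
| rho_sq: "i \<in> {1..n-1} \<Longrightarrow> (pos_word [Rho i, Rho i], []) \<in> VT_rels n"
| sig_sig: "i \<in> {1..n-1} \<Longrightarrow> j \<in> {1..n-1} \<Longrightarrow> \<bar>int i - int j\<bar> \<ge> 2 \<Longrightarrow>
    (pos_word [Sig i, Sig j], pos_word [Sig j, Sig i]) \<in> VT_rels n"
| rho_rho: "i \<in> {1..n-1} \<Longrightarrow> j \<in> {1..n-1} \<Longrightarrow> \<bar>int i - int j\<bar> \<ge> 2 \<Longrightarrow>
    (pos_word [Rho i, Rho j], pos_word [Rho j, Rho i]) \<in> VT_rels n"
| rho_sig: "i \<in> {1..n-1} \<Longrightarrow> j \<in> {1..n-1} \<Longrightarrow> \<bar>int i - int j\<bar> \<ge> 2 \<Longrightarrow>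
    (pos_word [Rho i, Sig j], pos_word [Sig j, Rho i]) \<in> VT_rels n"
| braid: "i \<in> {1..n-2} \<Longrightarrow>
    (pos_word [Rho i, Rho (i+1), Rho i], pos_word [Rho (i+1), Rho i, Rho (i+1)]) \<in> VT_rels n"
| mixed: "i \<in> {1..n-2} \<Longrightarrow>
    (pos_word [Rho i, Rho (i+1), Sig i], pos_word [Sig (i+1), Rho i, Rho (i+1)]) \<in> VT_rels n"

definition VT :: "nat \<Rightarrow> vt_gen gword set monoid" where
  "VT n = presented_group (VT_gens n) (VT_rels n)"

fun gen_perm :: "vt_gen \<Rightarrow> nat \<Rightarrow> nat" where
  "gen_perm (Sig i) = transpose i (i+1)"
| "gen_perm (Rho i) = transpose i (i+1)"

definition VT_proj :: "nat \<Rightarrow> vt_gen gword set \<Rightarrow> (nat \<Rightarrow> nat)" where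
  "VT_proj n = presented_hom (sym_group n) gen_perm"

definition PVT :: "nat \<Rightarrow> vt_gen gword set set" where
  "PVT n = kernel (VT n) (sym_group n) (VT_proj n)"

definition VT_quot :: "nat \<Rightarrow> vt_gen gword set set monoid" where
  "VT_quot n = VT n Mod derived (VT n) (PVT n)"

text \<open>The map induced on cosets: \<open>VT_proj n\<close> is constant on each coset of \<open>derived (VT n) (PVT n)\<close>.\<close>

definition VT_proj_bar :: "nat \<Rightarrow> vt_gen gword set set \<Rightarrow> (nat \<Rightarrow> nat)" where
  "VT_proj_bar n C = the_elem (VT_proj n ` C)"

lemma VT_proj_data: "presented_hom_data (sym_group n) (VT_gens n) (VT_rels n) gen_perm"
proof -
  interpret group "sym_group n" by (rule sym_group_is_group)
  have tr: "transpose i (Suc i) permutes {1..n}" if "i \<in> {1..n-1}" for i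
    using that by (intro permutes_swap_id) auto
  have comm: "transpose i (Suc i) \<circ> transpose j (Suc j) = transpose j (Suc j) \<circ> transpose i (Suc i)"
    if "2 \<le> \<bar>int i - int j\<bar>" for i j
    using that by (intro ext) (auto simp: transpose_def)
  show ?thesis
  proof unfold_locales
    show "gen_perm s \<in> carrier (sym_group n)" if "s \<in> VT_gens n" for s
      using that tr by (auto simp: VT_gens_def sym_group_def)
    show "word_value (sym_group n) gen_perm u = word_value (sym_group n) gen_perm v"
      if "(u, v) \<in> VT_rels n" for u v
      using that
    proof cases
      case (braid i)
      have "transpose i (Suc i) \<circ> (transpose (Suc i) (Suc (Suc i)) \<circ> transpose i (Suc i)) =
          transpose (Suc i) (Suc (Suc i)) \<circ> (transpose i (Suc i) \<circ> transpose (Suc i) (Suc (Suc i)))"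
        by (rule ext) (simp add: transpose_def)
      then show ?thesis
        using braid by (simp add: word_value_def pos_word_def sym_group_def)
    next
      case (mixed i)
      have "transpose i (Suc i) \<circ> (transpose (Suc i) (Suc (Suc i)) \<circ> transpose i (Suc i)) =
          transpose (Suc i) (Suc (Suc i)) \<circ> (transpose i (Suc i) \<circ> transpose (Suc i) (Suc (Suc i)))"
        by (rule ext) (simp add: transpose_def)
      then show ?thesis
        using mixed by (simp add: word_value_def pos_word_def sym_group_def)
    qed (simp_all add: word_value_def pos_word_def sym_group_def comm)
  qed
qed

lemma VT_proj_hom: "VT_proj n \<in> hom (VT n) (sym_group n)"
  unfolding VT_proj_def VT_def by (rule presented_hom_data.presented_hom_hom[OF VT_proj_data])

lemma VT_proj_gen:
  assumes "i \<in> {1..n-1}"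
  shows "VT_proj n (word_class (VT_gens n) (VT_rels n) [(Sig i, True)]) = transpose i (i+1)"
    and "VT_proj n (word_class (VT_gens n) (VT_rels n) [(Rho i, True)]) = transpose i (i+1)"
  unfolding VT_proj_def
  by (subst presented_hom_data.presented_hom_class[OF VT_proj_data];
      use assms in \<open>simp add: VT_gens_def word_value_def sym_group_def\<close>)+

section \<open>Exact sequences and crystallographic groups\<close>

definition int_power_group :: "nat \<Rightarrow> (nat \<Rightarrow> int) monoid" where
  "int_power_group m = product_group {..<m} (\<lambda>_. integer_group)"

text \<open>The library's exact sequences require all groups to have the same element type.\<close>

definition short_exact ::
  "('a, 'p) monoid_scheme \<Rightarrow> ('b, 'q) monoid_scheme \<Rightarrow> ('c, 'r) monoid_scheme \<Rightarrow>
    ('a \<Rightarrow> 'b) \<Rightarrow> ('b \<Rightarrow> 'c) \<Rightarrow> bool" where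
  "short_exact A B C f g \<longleftrightarrow>
     group A \<and> group B \<and> group C \<and> f \<in> mon A B \<and> g \<in> epi B C \<and> f ` carrier A = kernel B C g"

definition split_short_exact ::
  "('a, 'p) monoid_scheme \<Rightarrow> ('b, 'q) monoid_scheme \<Rightarrow> ('c, 'r) monoid_scheme \<Rightarrow>
    ('a \<Rightarrow> 'b) \<Rightarrow> ('b \<Rightarrow> 'c) \<Rightarrow> bool" where
  "split_short_exact A B C f g \<longleftrightarrow>
     short_exact A B C f g \<and> (\<exists>s\<in>hom C B. \<forall>c\<in>carrier C. g (s c) = c)"

text \<open>For a short exact sequence with abelian \<open>A\<close>, the map \<open>\<theta>\<close> from \<open>C\<close> to the automorphism group
  of \<open>A\<close> with \<open>f (\<theta> (g b) a) = b f(a) b\<inverse>\<close> exists and is unique: \<open>f\<close> is injective, \<open>g\<close> is surjective,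
  and elements of \<open>AutoGroup A\<close> are extensional functions.\<close>

definition induced_by_conjugation ::
  "('a, 'p) monoid_scheme \<Rightarrow> ('b, 'q) monoid_scheme \<Rightarrow> ('c, 'r) monoid_scheme \<Rightarrow>
    ('a \<Rightarrow> 'b) \<Rightarrow> ('b \<Rightarrow> 'c) \<Rightarrow> ('c \<Rightarrow> 'a \<Rightarrow> 'a) \<Rightarrow> bool" where
  "induced_by_conjugation A B C f g \<theta> \<longleftrightarrow>
     \<theta> \<in> hom C (AutoGroup A) \<and>
     (\<forall>b\<in>carrier B. \<forall>a\<in>carrier A. f (\<theta> (g b) a) = b \<otimes>\<^bsub>B\<^esub> f a \<otimes>\<^bsub>B\<^esub> inv\<^bsub>B\<^esub> b)"

text \<open>The finite group \<open>\<Phi>\<close> is isomorphic to the quotient of \<open>G\<close> by the image of \<open>\<iota>\<close>, whose elements are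
  subsets of \<open>G\<close>; so letting it range over groups on \<open>'a set\<close> is no restriction.\<close>

definition crystallographic :: "'a monoid \<Rightarrow> bool" where
  "crystallographic G \<longleftrightarrow>
     (\<exists>(m::nat) (\<Phi> :: 'a set monoid) \<iota> p.
        short_exact (int_power_group m) G \<Phi> \<iota> p \<and> finite (carrier \<Phi>) \<and>
        (\<exists>\<theta>. induced_by_conjugation (int_power_group m) G \<Phi> \<iota> p \<theta> \<and> inj_on \<theta> (carrier \<Phi>)))"

end

theory Submission
  imports Defs "HOL-Algebra.FiniteProduct"
begin

text \<open>
  Why the theorem holds. Write \<open>V\<close> for the virtual twin group, \<open>P\<close> for its pure subgroup and
  \<open>Q = V / [P, P]\<close>. The \<open>\<rho>\<^sub>i\<close> satisfy the Coxeter relations of the symmetric group, so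
  \<open>\<rho>\<^sub>i \<mapsto> \<rho>\<^sub>i\<close> defines a section \<open>lift\<close> of \<open>V \<rightarrow> S\<^sub>n\<close>; this gives the splitting. Conjugating
  \<open>\<sigma>\<^sub>n\<^sub>-\<^sub>1 \<rho>\<^sub>n\<^sub>-\<^sub>1 \<in> P\<close> by the lift of a permutation gives an element \<open>pure_gen i j\<close> that depends only
  on the image \<open>(i, j)\<close> of the pair \<open>(n - 1, n)\<close>, because \<open>\<sigma>\<^sub>n\<^sub>-\<^sub>1 \<rho>\<^sub>n\<^sub>-\<^sub>1\<close> commutes with the lifts of
  the permutations fixing both points; in particular \<open>pure_gen i (i + 1) = \<sigma>\<^sub>i \<rho>\<^sub>i\<close>. These elements
  satisfy \<open>pure_gen j i = inv (pure_gen i j)\<close>, they are permuted by the section, and they generate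
  \<open>P\<close> (lemma \<open>kernel_in_generate_pure_gens\<close>). Hence \<open>P / [P, P]\<close> is an abelian group
  generated by the \<open>n (n - 1) / 2\<close> classes with \<open>i < j\<close>.

  That these classes are independent is seen by letting \<open>V\<close> act on the integer functions of two
  natural numbers by affine maps: \<open>\<rho>\<^sub>i\<close> permutes both arguments by \<open>(i, i + 1)\<close>, and \<open>\<sigma>\<^sub>i\<close> does the
  same and then adds the function \<open>skew_unit i (i + 1)\<close>, which is \<open>1\<close> at \<open>(i, i + 1)\<close> and \<open>-1\<close> at
  \<open>(i + 1, i)\<close> and \<open>0\<close> elsewhere. An element with trivial permutation acts as a translation, so \<open>[P, P]\<close> acts
  trivially, the action descends to \<open>Q\<close>, and \<open>pure_gen i j\<close> translates by \<open>skew_unit i j\<close>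
  (lemma \<open>translation_pure_gen\<close>). Reading off the values at \<open>(i, j)\<close> with \<open>i < j\<close> recovers the
  exponents, so the kernel of \<open>Q \<rightarrow> S\<^sub>n\<close> is free abelian on these classes.

  Finally \<open>Q\<close> is crystallographic with holonomy group \<open>S\<^sub>n\<close>: an element over the permutation \<open>w\<close>
  conjugates \<open>pure_gen i j\<close> to \<open>pure_gen (w i) (w j)\<close>, and these two elements translate by the same
  function only if \<open>w i = i\<close>; so an element acting trivially lies over the identity.
\<close>

section \<open>Crystallographic groups from faithful conjugation actions\<close>

lemma comm_group_int_power_group: "comm_group (int_power_group m)"
proof -
  have "group (int_power_group m)" by (simp add: int_power_group_def)
  then show ?thesis
    by (rule group.group_comm_groupI) (auto simp: int_power_group_def add.commute)
qed

text \<open>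
  Conjugation by \<open>b\<close> preserves the kernel \<open>f ` A\<close>, hence pulls back along \<open>f\<close> to an automorphism of
  \<open>A\<close>; since \<open>A\<close> is abelian this automorphism depends only on \<open>g b\<close>.
\<close>

lemma conjugation_action_exists:
  assumes ses: "short_exact A B C f g" and "comm_group A"
  shows "\<exists>\<theta>. induced_by_conjugation A B C f g \<theta>"
proof -
  interpret A: comm_group A by fact
  interpret B: group B using ses by (simp add: short_exact_def)
  interpret C: group C using ses by (simp add: short_exact_def)
  have f: "f \<in> hom A B" and f_inj: "inj_on f (carrier A)"
    and g: "g \<in> hom B C" and g_surj: "g ` carrier B = carrier C"
    and ker: "f ` carrier A = kernel B C g"
    using ses by (auto simp: short_exact_def mon_def epi_def)
  interpret g: group_hom B C g using g by unfold_locales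
  have f_cl [simp]: "f a \<in> carrier B" if "a \<in> carrier A" for a using hom_in_carrier[OF f that] .
  have f_mult: "f (a \<otimes>\<^bsub>A\<^esub> a') = f a \<otimes>\<^bsub>B\<^esub> f a'" if "a \<in> carrier A" "a' \<in> carrier A" for a a'
    using hom_mult[OF f that] .
  have gf: "g (f a) = \<one>\<^bsub>C\<^esub>" if "a \<in> carrier A" for a
    using ker that by (auto simp: kernel_def)
  define act where "act b = (\<lambda>a\<in>carrier A. inv_into (carrier A) f (b \<otimes>\<^bsub>B\<^esub> f a \<otimes>\<^bsub>B\<^esub> inv\<^bsub>B\<^esub> b))" for b
  have conj: "b \<otimes>\<^bsub>B\<^esub> f a \<otimes>\<^bsub>B\<^esub> inv\<^bsub>B\<^esub> b \<in> f ` carrier A" if "b \<in> carrier B" "a \<in> carrier A" for a b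
    unfolding ker kernel_def using that by (simp add: gf)
  have act_cl: "act b a \<in> carrier A" and f_act: "f (act b a) = b \<otimes>\<^bsub>B\<^esub> f a \<otimes>\<^bsub>B\<^esub> inv\<^bsub>B\<^esub> b"
    if "b \<in> carrier B" "a \<in> carrier A" for a b
    using inv_into_into[OF conj[OF that]] f_inv_into_f[OF conj[OF that]] that by (simp_all add: act_def)
  have act_eqI: "act b a = a'" if "b \<in> carrier B" "a \<in> carrier A" "a' \<in> carrier A"
      "b \<otimes>\<^bsub>B\<^esub> f a \<otimes>\<^bsub>B\<^esub> inv\<^bsub>B\<^esub> b = f a'" for a a' b
    using f_act[OF that(1,2)] that(3,4) act_cl[OF that(1,2)] by (intro inj_onD[OF f_inj]) simp_all
  have act_mult: "act (b \<otimes>\<^bsub>B\<^esub> b') a = act b (act b' a)"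
    if "b \<in> carrier B" "b' \<in> carrier B" "a \<in> carrier A" for a b b'
  proof (rule act_eqI)
    show "b \<otimes>\<^bsub>B\<^esub> b' \<otimes>\<^bsub>B\<^esub> f a \<otimes>\<^bsub>B\<^esub> inv\<^bsub>B\<^esub> (b \<otimes>\<^bsub>B\<^esub> b') = f (act b (act b' a))"
      using that by (simp add: act_cl f_act B.m_assoc B.inv_mult_group)
  qed (use that act_cl in simp_all)
  have act_kernel: "act (f a') a = a" if "a' \<in> carrier A" "a \<in> carrier A" for a a'
  proof (rule act_eqI)
    have "f a' \<otimes>\<^bsub>B\<^esub> f a = f a \<otimes>\<^bsub>B\<^esub> f a'" 
      using that f_mult[of a' a] f_mult[of a a'] A.m_comm[of a' a] by simp
    then show "f a' \<otimes>\<^bsub>B\<^esub> f a \<otimes>\<^bsub>B\<^esub> inv\<^bsub>B\<^esub> f a' = f a" using that by (simp add: B.m_assoc)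
  qed (use that in simp_all)
  \<comment> \<open>An element of the kernel acts trivially because the kernel is abelian, so \<open>act b\<close> depends
    on \<open>g b\<close> only.\<close>
  have act_cong: "act b = act b'" if b: "b \<in> carrier B" "b' \<in> carrier B" "g b = g b'" for b b'
  proof -
    have "inv\<^bsub>B\<^esub> b' \<otimes>\<^bsub>B\<^esub> b \<in> kernel B C g" using b by (simp add: kernel_def)
    then obtain a' where a': "a' \<in> carrier A" "inv\<^bsub>B\<^esub> b' \<otimes>\<^bsub>B\<^esub> b = f a'" using ker by blast
    then have eq: "b = b' \<otimes>\<^bsub>B\<^esub> f a'" using b B.inv_solve_left[of "f a'" b' b] by simp
    show ?thesis
    proof
      fix a
      show "act b a = act b' a"
      proof (cases "a \<in> carrier A")
        case True
        then show ?thesis using a' b by (simp add: eq act_mult act_kernel)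
      next
        case False
        then show ?thesis by (simp add: act_def)
      qed
    qed
  qed
  define \<theta> where "\<theta> c = act (inv_into (carrier B) g c)" for c
  have \<theta>_g: "\<theta> (g b) = act b" if "b \<in> carrier B" for b
  proof -
    have "g b \<in> g ` carrier B" using that by simp
    then show ?thesis
      unfolding \<theta>_def using that by (intro act_cong) (auto simp: inv_into_into f_inv_into_f)
  qed
  have act_auto: "act b \<in> auto A" if b: "b \<in> carrier B" for b
  proof -
    have "act b \<in> hom A A"
    proof (rule homI)
      fix a a' assume a: "a \<in> carrier A" "a' \<in> carrier A"
      show "act b (a \<otimes>\<^bsub>A\<^esub> a') = act b a \<otimes>\<^bsub>A\<^esub> act b a'"
      proof (rule act_eqI)
        show "b \<otimes>\<^bsub>B\<^esub> f (a \<otimes>\<^bsub>A\<^esub> a') \<otimes>\<^bsub>B\<^esub> inv\<^bsub>B\<^esub> b = f (act b a \<otimes>\<^bsub>A\<^esub> act b a')"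
        proof -
          have "inv\<^bsub>B\<^esub> b \<otimes>\<^bsub>B\<^esub> (b \<otimes>\<^bsub>B\<^esub> x) = x" if "x \<in> carrier B" for x
            using b that by (simp add: B.m_assoc[symmetric])
          then show ?thesis using a b by (simp add: f_mult f_act act_cl B.m_assoc)
        qed
      qed (use a b act_cl in simp_all)
    qed (use b act_cl in simp)
    moreover have "bij_betw (act b) (carrier A) (carrier A)"
    proof (rule bij_betwI[where g = "act (inv\<^bsub>B\<^esub> b)"])
      have one: "act \<one>\<^bsub>B\<^esub> a = a" if "a \<in> carrier A" for a
        using that by (intro act_eqI) simp_all
      show "act (inv\<^bsub>B\<^esub> b) (act b a) = a" if "a \<in> carrier A" for a
        using that b one act_mult[of "inv\<^bsub>B\<^esub> b" b a] by simp
      show "act b (act (inv\<^bsub>B\<^esub> b) a) = a" if "a \<in> carrier A" for a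
        using that b one act_mult[of b "inv\<^bsub>B\<^esub> b" a] by simp
    qed (use b act_cl in auto)
    ultimately show ?thesis by (simp add: auto_def Bij_def act_def)
  qed
  have "\<theta> \<in> hom C (AutoGroup A)"
  proof (rule homI)
    fix c assume "c \<in> carrier C"
    then obtain b where "b \<in> carrier B" "c = g b" using g_surj by blast
    then show "\<theta> c \<in> carrier (AutoGroup A)" by (simp add: \<theta>_g act_auto AutoGroup_def)
  next
    fix c d assume "c \<in> carrier C" "d \<in> carrier C"
    then obtain b b' where b: "b \<in> carrier B" "c = g b" "b' \<in> carrier B" "d = g b'"
      using g_surj by blast
    have "act (b \<otimes>\<^bsub>B\<^esub> b') a = compose (carrier A) (act b) (act b') a" for a
      using b act_mult by (simp add: compose_def act_def)
    then have "act (b \<otimes>\<^bsub>B\<^esub> b') = compose (carrier A) (act b) (act b')" by (rule ext)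
    moreover have "\<theta> (c \<otimes>\<^bsub>C\<^esub> d) = act (b \<otimes>\<^bsub>B\<^esub> b')"
      using b \<theta>_g[of "b \<otimes>\<^bsub>B\<^esub> b'"] by simp
    moreover have "act b \<in> Bij (carrier A)" "act b' \<in> Bij (carrier A)"
      using act_auto b by (auto simp: auto_def)
    ultimately show "\<theta> (c \<otimes>\<^bsub>C\<^esub> d) = \<theta> c \<otimes>\<^bsub>AutoGroup A\<^esub> \<theta> d"
      using b by (simp add: \<theta>_g AutoGroup_def BijGroup_def)
  qed
  then have "induced_by_conjugation A B C f g \<theta>"
    unfolding induced_by_conjugation_def using \<theta>_g f_act by simp
  then show ?thesis by blast
qed

text \<open>
  The definition asks for a finite quotient that lives on subsets of \<open>G\<close>. Replacing an arbitrary
  quotient \<open>C\<close> by \<open>G Mod kernel G C p\<close> provides it, and a direct condition on conjugation replaces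
  the injectivity of the induced representation.
\<close>

lemma crystallographicI:
  fixes G :: "'a monoid"
  assumes ses: "short_exact (int_power_group m) G C \<iota> p" and fin: "finite (carrier C)"
    and faithful: "\<And>b. \<lbrakk>b \<in> carrier G;
        \<And>a. a \<in> carrier (int_power_group m) \<Longrightarrow> b \<otimes>\<^bsub>G\<^esub> \<iota> a \<otimes>\<^bsub>G\<^esub> inv\<^bsub>G\<^esub> b = \<iota> a\<rbrakk> \<Longrightarrow> p b = \<one>\<^bsub>C\<^esub>"
  shows "crystallographic G"
proof -
  let ?A = "int_power_group m"
  let ?N = "kernel G C p"
  interpret G: group G using ses by (simp add: short_exact_def)
  interpret C: group C using ses by (simp add: short_exact_def)
  have \<iota>: "\<iota> \<in> hom ?A G" using ses by (simp add: short_exact_def mon_def)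
  interpret p: group_hom G C p
    using ses by unfold_locales (simp add: short_exact_def epi_def)
  interpret N: normal ?N G by (rule p.normal_kernel)
  let ?\<Phi> = "G Mod ?N" and ?q = "\<lambda>a. ?N #>\<^bsub>G\<^esub> a"
  have coset_one: "?q b = ?N \<longleftrightarrow> b \<in> ?N" if "b \<in> carrier G" for b
    using G.coset_join1[OF _ that p.subgroup_kernel] G.coset_join2[OF that p.subgroup_kernel]
    by blast
  have qker: "kernel G ?\<Phi> ?q = ?N"
  proof -
    have "kernel G ?\<Phi> ?q = {b \<in> carrier G. b \<in> ?N}"
      unfolding kernel_def[of G ?\<Phi>] one_FactGroup using coset_one by blast
    then show ?thesis using N.subset by blast
  qed
  have ses': "short_exact ?A G ?\<Phi> \<iota> ?q"
    using ses N.r_coset_hom_Mod N.factorgroup_is_group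
    by (simp add: short_exact_def qker epi_def carrier_FactGroup)
  have "finite ((\<lambda>X. the_elem (p ` X)) ` carrier ?\<Phi>)"
    using hom_in_carrier[OF p.FactGroup_hom] by (intro finite_subset[OF _ fin]) auto
  then have fin': "finite (carrier ?\<Phi>)"
    using p.FactGroup_inj_on by (rule finite_imageD)
  obtain \<theta> where \<theta>: "induced_by_conjugation ?A G ?\<Phi> \<iota> ?q \<theta>"
    using conjugation_action_exists[OF ses' comm_group_int_power_group] by blast
  have "inj_on \<theta> (carrier ?\<Phi>)"
  proof (rule inj_onI)
    fix X Y assume XY: "X \<in> carrier ?\<Phi>" "Y \<in> carrier ?\<Phi>" "\<theta> X = \<theta> Y"
    then obtain b b' where b: "b \<in> carrier G" "X = ?q b" "b' \<in> carrier G" "Y = ?q b'"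
      unfolding carrier_FactGroup by blast
    have "p (inv\<^bsub>G\<^esub> b' \<otimes>\<^bsub>G\<^esub> b) = \<one>\<^bsub>C\<^esub>"
    proof (rule faithful)
      fix a assume a: "a \<in> carrier ?A"
      have cl: "\<iota> a \<in> carrier G" using hom_in_carrier[OF \<iota> a] .
      have "b \<otimes>\<^bsub>G\<^esub> \<iota> a \<otimes>\<^bsub>G\<^esub> inv\<^bsub>G\<^esub> b = b' \<otimes>\<^bsub>G\<^esub> \<iota> a \<otimes>\<^bsub>G\<^esub> inv\<^bsub>G\<^esub> b'"
      proof -
        have conj: "\<iota> (\<theta> (?q d) a) = d \<otimes>\<^bsub>G\<^esub> \<iota> a \<otimes>\<^bsub>G\<^esub> inv\<^bsub>G\<^esub> d" if "d \<in> carrier G" for d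
          using \<theta> a that by (simp add: induced_by_conjugation_def)
        show ?thesis using conj[OF b(1)] conj[OF b(3)] XY(3) b(2,4) by simp
      qed
      then have "inv\<^bsub>G\<^esub> b' \<otimes>\<^bsub>G\<^esub> (b \<otimes>\<^bsub>G\<^esub> \<iota> a \<otimes>\<^bsub>G\<^esub> inv\<^bsub>G\<^esub> b) \<otimes>\<^bsub>G\<^esub> b' =
          inv\<^bsub>G\<^esub> b' \<otimes>\<^bsub>G\<^esub> (b' \<otimes>\<^bsub>G\<^esub> \<iota> a \<otimes>\<^bsub>G\<^esub> inv\<^bsub>G\<^esub> b') \<otimes>\<^bsub>G\<^esub> b'"
        by simp
      also have "\<dots> = (inv\<^bsub>G\<^esub> b' \<otimes>\<^bsub>G\<^esub> b') \<otimes>\<^bsub>G\<^esub> \<iota> a \<otimes>\<^bsub>G\<^esub> (inv\<^bsub>G\<^esub> b' \<otimes>\<^bsub>G\<^esub> b')"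
        using b cl by (simp only: G.m_assoc G.m_closed G.inv_closed)
      finally show "inv\<^bsub>G\<^esub> b' \<otimes>\<^bsub>G\<^esub> b \<otimes>\<^bsub>G\<^esub> \<iota> a \<otimes>\<^bsub>G\<^esub> inv\<^bsub>G\<^esub> (inv\<^bsub>G\<^esub> b' \<otimes>\<^bsub>G\<^esub> b) = \<iota> a"
        using b cl by (simp add: G.m_assoc G.inv_mult_group)
    qed (use b in simp)
    then have "inv\<^bsub>C\<^esub> p b' \<otimes>\<^bsub>C\<^esub> p b = \<one>\<^bsub>C\<^esub>" using b(1,3) by simp
    then have inv_eq: "inv\<^bsub>C\<^esub> p b = inv\<^bsub>C\<^esub> p b'" using b(1,3) by (intro C.inv_equality) simp_all
    have "p b = inv\<^bsub>C\<^esub> (inv\<^bsub>C\<^esub> p b)" using b(1) by simp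
    also have "\<dots> = p b'" unfolding inv_eq using b(3) by simp
    finally have "p (b \<otimes>\<^bsub>G\<^esub> inv\<^bsub>G\<^esub> b') = \<one>\<^bsub>C\<^esub>" using b(1,3) by simp
    then have "b \<otimes>\<^bsub>G\<^esub> inv\<^bsub>G\<^esub> b' \<in> ?N" unfolding kernel_def using b(1,3) by simp
    from G.rcosI[OF this N.subset b(3)] have "b \<in> ?q b'" using b(1,3) by (simp add: G.m_assoc)
    then have "?q b' = ?q b" using b(3) p.subgroup_kernel by (rule G.repr_independence)
    then show "X = Y" by (simp only: b(2,4))
  qed
  then show ?thesis
    unfolding crystallographic_def
    by (intro exI[of _ m] exI[of _ ?\<Phi>] exI[of _ \<iota>] exI[of _ ?q] conjI ses' fin' exI[of _ \<theta>] \<theta>)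
qed

section \<open>The Coxeter presentation of the symmetric group\<close>

lemma (in group) generate_commute:
  assumes "S \<subseteq> carrier G" "z \<in> carrier G" "\<And>s. s \<in> S \<Longrightarrow> z \<otimes> s = s \<otimes> z"
    and "x \<in> generate G S"
  shows "z \<otimes> x = x \<otimes> z"
  using assms(4)
proof (induction rule: generate.induct)
  case one
  then show ?case using assms(2) by simp
next
  case (incl h)
  then show ?case using assms(3) by simp
next
  case (inv h)
  then have h: "h \<in> carrier G" "z \<otimes> h = h \<otimes> z" using assms(1,3) by auto
  have "inv h \<otimes> z = inv h \<otimes> (z \<otimes> h) \<otimes> inv h" using h(1) assms(2) by (simp add: m_assoc)
  also have "\<dots> = z \<otimes> inv h" using h assms(2) by (simp flip: m_assoc)
  finally show ?case by simp
next
  case (eng h1 h2)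
  then have "h1 \<in> carrier G" "h2 \<in> carrier G" using generate_in_carrier[OF assms(1)] by auto
  then have "z \<otimes> (h1 \<otimes> h2) = h1 \<otimes> (z \<otimes> h2)"
    using eng.IH(1) assms(2) by (simp flip: m_assoc)
  also have "\<dots> = h1 \<otimes> h2 \<otimes> z"
    using eng.IH(2) \<open>h1 \<in> carrier G\<close> \<open>h2 \<in> carrier G\<close> assms(2) by (simp add: m_assoc)
  finally show ?case .
qed

text \<open>
  A group over \<open>S\<^sub>n\<close> in which the adjacent transpositions have preferred preimages \<open>r i\<close> satisfying the
  Coxeter relations. The content of this section is that the \<open>r i\<close> generate a subgroup mapped
  isomorphically onto \<open>S\<^sub>n\<close>, that is, that the Coxeter relations present the symmetric group.
\<close>

locale adjacent_lifts = group G for G (structure) +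
  fixes n :: nat and \<pi> :: "'a \<Rightarrow> nat \<Rightarrow> nat" and r :: "nat \<Rightarrow> 'a"
  assumes proj_hom: "\<pi> \<in> hom G (sym_group n)"
    and r_closed: "\<lbrakk>1 \<le> i; i < n\<rbrakk> \<Longrightarrow> r i \<in> carrier G"
    and proj_r: "\<lbrakk>1 \<le> i; i < n\<rbrakk> \<Longrightarrow> \<pi> (r i) = transpose i (Suc i)"
    and r_square: "\<lbrakk>1 \<le> i; i < n\<rbrakk> \<Longrightarrow> r i \<otimes> r i = \<one>"
    and r_commute: "\<lbrakk>1 \<le> i; Suc i < j; j < n\<rbrakk> \<Longrightarrow> r i \<otimes> r j = r j \<otimes> r i"
    and r_braid: "\<lbrakk>1 \<le> i; Suc i < n\<rbrakk> \<Longrightarrow> r i \<otimes> (r (Suc i) \<otimes> r i) = r (Suc i) \<otimes> (r i \<otimes> r (Suc i))"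
begin

lemma proj_mult: "\<lbrakk>x \<in> carrier G; y \<in> carrier G\<rbrakk> \<Longrightarrow> \<pi> (x \<otimes> y) = \<pi> x \<circ> \<pi> y"
  using hom_mult[OF proj_hom] by (simp add: sym_group_mult)

lemma proj_group_hom: "group_hom G (sym_group n) \<pi>"
  using proj_hom sym_group_is_group by (simp add: group_hom_def group_hom_axioms_def)

lemma proj_one: "\<pi> \<one> = id"
  using group_hom.hom_one[OF proj_group_hom] by (simp add: sym_group_one)

lemma proj_permutes: "x \<in> carrier G \<Longrightarrow> \<pi> x permutes {1..n}"
  using hom_in_carrier[OF proj_hom] by (simp add: sym_group_carrier)

lemma proj_inv: "x \<in> carrier G \<Longrightarrow> \<pi> (inv x) = inv' (\<pi> x)"
  using group_hom.hom_inv[OF proj_group_hom] proj_permutes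
  by (simp add: sym_group_carrier)

lemma r_inv: "\<lbrakk>1 \<le> i; i < n\<rbrakk> \<Longrightarrow> inv (r i) = r i"
  using inv_equality r_closed r_square by blast

text \<open>
  The subgroup lying over the permutations of \<open>1, \<dots>, k\<close>; the presentation is proved by induction
  along this chain.
\<close>

definition parabolic :: "nat \<Rightarrow> 'a set" where
  "parabolic k = generate G (r ` {1..<k})"

lemma parabolic_subgroup: "k \<le> n \<Longrightarrow> subgroup (parabolic k) G"
  unfolding parabolic_def by (intro generate_is_subgroup) (auto simp: r_closed)

lemma parabolic_closed: "\<lbrakk>k \<le> n; x \<in> parabolic k\<rbrakk> \<Longrightarrow> x \<in> carrier G"
  using parabolic_subgroup subgroup.mem_carrier by metis

lemma parabolic_r: "\<lbrakk>1 \<le> i; i < k\<rbrakk> \<Longrightarrow> r i \<in> parabolic k"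
  unfolding parabolic_def by (auto intro: generate.incl)

lemma parabolic_mult: "\<lbrakk>x \<in> parabolic k; y \<in> parabolic k\<rbrakk> \<Longrightarrow> x \<otimes> y \<in> parabolic k"
  unfolding parabolic_def by (rule generate.eng)

lemma parabolic_mono: "k \<le> l \<Longrightarrow> parabolic k \<subseteq> parabolic l"
  unfolding parabolic_def by (intro mono_generate) auto

text \<open>
  The \<open>r i\<close> are involutions, so it suffices to extend words by single letters on the right.
\<close>

lemma parabolic_induct [consumes 2, case_names one gen]:
  assumes "k \<le> n" "x \<in> parabolic k"
    and one: "P \<one>"
    and gen: "\<And>x i. \<lbrakk>x \<in> parabolic k; P x; 1 \<le> i; i < k\<rbrakk> \<Longrightarrow> P (x \<otimes> r i)"
  shows "P x"
proof -
  have "P (y \<otimes> x)" if "y \<in> parabolic k" "P y" for y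
    using assms(2) that unfolding parabolic_def[of k]
  proof (induction arbitrary: y rule: generate.induct)
    case one
    then show ?case using parabolic_closed[OF assms(1)] by (simp add: parabolic_def)
  next
    case (incl h)
    then show ?case using gen by (auto simp: parabolic_def)
  next
    case (inv h)
    then show ?case using gen assms(1) by (auto simp: parabolic_def r_inv)
  next
    case (eng h1 h2)
    have "y \<otimes> h1 \<in> generate G (r ` {1..<k})"
      using eng.hyps(1) eng.prems(1) by (rule generate.eng[rotated])
    moreover have "P (y \<otimes> h1)" using eng by blast
    ultimately have "P (y \<otimes> h1 \<otimes> h2)" by (rule eng.IH(2))
    moreover have "y \<in> carrier G" "h1 \<in> carrier G" "h2 \<in> carrier G"
      using eng.hyps eng.prems(1) parabolic_closed[OF assms(1)] by (auto simp: parabolic_def)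
    ultimately show ?case by (simp add: m_assoc)
  qed
  from this[of \<one>] show ?thesis
    using one parabolic_closed[OF assms(1,2)] by (simp add: parabolic_def generate.one)
qed

lemma proj_parabolic:
  assumes "k \<le> n" "x \<in> parabolic k"
  shows "\<pi> x permutes {1..k}"
  using assms
proof (induction rule: parabolic_induct)
  case one
  then show ?case using permutes_id[of "{1..k}"] by (simp add: proj_one id_def)
next
  case (gen x i)
  have "transpose i (Suc i) permutes {1..k}"
    using gen by (intro permutes_swap_id) auto
  then have "\<pi> x \<circ> transpose i (Suc i) permutes {1..k}"
    using gen.IH permutes_compose by blast
  moreover have "\<pi> (x \<otimes> r i) = \<pi> x \<circ> transpose i (Suc i)"
    using gen.hyps assms(1) parabolic_closed[OF assms(1)] by (simp add: proj_mult proj_r r_closed)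
  ultimately show ?case by (simp only:)
qed

text \<open>
  The element \<open>coset_rep k j\<close> is the descending product \<open>r k \<otimes> r (k - 1) \<otimes> \<dots> \<otimes> r j\<close>, which is empty
  for \<open>j = Suc k\<close>; its permutation moves \<open>j\<close> to \<open>Suc k\<close>. These are representatives of the
  right cosets of \<open>parabolic k\<close> in \<open>parabolic (Suc k)\<close>.
\<close>

primrec coset_rep :: "nat \<Rightarrow> nat \<Rightarrow> 'a" where
  "coset_rep 0 j = \<one>"
| "coset_rep (Suc k) j = (if j \<le> Suc k then r (Suc k) \<otimes> coset_rep k j else \<one>)"

lemma coset_rep_closed: "\<lbrakk>k < n; 1 \<le> j\<rbrakk> \<Longrightarrow> coset_rep k j \<in> carrier G"
  by (induction k) (auto simp: r_closed)

lemma coset_rep_top: "k < j \<Longrightarrow> coset_rep k j = \<one>"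
  by (cases k) auto

lemma coset_rep_snoc:
  "\<lbrakk>k < n; 1 \<le> j; j \<le> k\<rbrakk> \<Longrightarrow> coset_rep k j = coset_rep k (Suc j) \<otimes> r j"
proof (induction k)
  case (Suc k)
  show ?case
  proof (cases "j = Suc k")
    case True
    then show ?thesis using Suc.prems by (simp add: coset_rep_top r_closed)
  next
    case False
    then show ?thesis using Suc by (simp add: m_assoc r_closed coset_rep_closed)
  qed
qed simp

lemma coset_rep_in_generate: "coset_rep k j \<in> generate G (r ` {j..k})"
proof (induction k)
  case 0
  show ?case by (simp only: coset_rep.simps generate.one)
next
  case (Suc k)
  have "r ` {j..k} \<subseteq> r ` {j..Suc k}" by (intro image_mono) simp
  then have 1: "coset_rep k j \<in> generate G (r ` {j..Suc k})" using Suc mono_generate by blast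
  have 2: "r (Suc k) \<in> generate G (r ` {j..Suc k})" if "j \<le> Suc k"
    using that by (intro generate.incl imageI) simp
  show ?case
  proof (cases "j \<le> Suc k")
    case True
    then show ?thesis using generate.eng[OF 2[OF True] 1] by simp
  next
    case False
    then show ?thesis by (simp only: coset_rep.simps if_False generate.one)
  qed
qed

lemma coset_rep_commute:
  assumes "k < n" "1 \<le> j" "1 \<le> i" "i < n" "Suc i < j \<or> Suc k < i"
  shows "coset_rep k j \<otimes> r i = r i \<otimes> coset_rep k j"
proof -
  have "r i \<otimes> s = s \<otimes> r i" if "s \<in> r ` {j..k}" for s
  proof -
    from that obtain l where "s = r l" "j \<le> l" "l \<le> k" by auto
    then show ?thesis using assms r_commute[of i l] r_commute[of l i] by auto
  qed
  moreover have "r ` {j..k} \<subseteq> carrier G" "r i \<in> carrier G"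
    using assms by (auto simp: r_closed)
  ultimately show ?thesis
    by (intro generate_commute[OF _ _ _ coset_rep_in_generate, symmetric]) blast+
qed

text \<open>
  A letter \<open>r (Suc i)\<close> passes from the right through the letters below \<open>i\<close>, meets
  \<open>r (Suc i) \<otimes> r i\<close>, turns into \<open>r i\<close> by the braid relation, and passes through the remaining letters.
\<close>

lemma coset_rep_shift:
  "\<lbrakk>k < n; 1 \<le> j; j \<le> i; Suc i \<le> k\<rbrakk> \<Longrightarrow> coset_rep k j \<otimes> r (Suc i) = r i \<otimes> coset_rep k j"
proof (induction k)
  case (Suc k)
  have cl: "r (Suc k) \<in> carrier G" "r i \<in> carrier G" "r (Suc i) \<in> carrier G"
      "coset_rep k j \<in> carrier G"
    using Suc.prems by (auto simp: r_closed coset_rep_closed)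
  show ?case
  proof (cases "i = k")
    case True
    then obtain l where k: "k = Suc l" using Suc.prems by (cases k) auto
    have cl': "coset_rep l j \<in> carrier G" "r k \<in> carrier G" "r (Suc k) \<in> carrier G"
      using Suc.prems k by (auto simp: r_closed coset_rep_closed)
    have "coset_rep (Suc k) j \<otimes> r (Suc i) = r (Suc k) \<otimes> r k \<otimes> (coset_rep l j \<otimes> r (Suc k))"
      using True k Suc.prems cl' by (simp add: m_assoc)
    also have "\<dots> = r (Suc k) \<otimes> (r k \<otimes> r (Suc k)) \<otimes> coset_rep l j"
      using coset_rep_commute[of l j "Suc k"] k Suc.prems cl' by (simp add: m_assoc)
    also have "\<dots> = r k \<otimes> (r (Suc k) \<otimes> r k) \<otimes> coset_rep l j"
      using r_braid[of k] k Suc.prems by simp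
    also have "\<dots> = r i \<otimes> coset_rep (Suc k) j"
      using True k Suc.prems cl' by (simp add: m_assoc)
    finally show ?thesis .
  next
    case False
    then have "coset_rep (Suc k) j \<otimes> r (Suc i) = r (Suc k) \<otimes> r i \<otimes> coset_rep k j"
      using Suc cl by (simp add: m_assoc)
    also have "\<dots> = r i \<otimes> r (Suc k) \<otimes> coset_rep k j"
      using r_commute[of i "Suc k"] False Suc.prems by simp
    finally show ?thesis using False Suc.prems cl by (simp add: m_assoc)
  qed
qed simp

text \<open>
  The union of the cosets of the \<open>k + 1\<close> representatives is stable under right multiplication by every
  generator: the letter \<open>r i\<close> either lengthens or shortens the descending product, or moves to its
  left as a generator of \<open>parabolic k\<close>.
\<close>

lemma parabolic_Suc_decomp:
  assumes "k < n" "x \<in> parabolic (Suc k)"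
  shows "\<exists>y\<in>parabolic k. \<exists>j\<in>{1..Suc k}. x = y \<otimes> coset_rep k j"
proof -
  have "Suc k \<le> n" using assms(1) by simp
  then show ?thesis using assms(2)
  proof (induction rule: parabolic_induct)
    case one
    have "\<one> = \<one> \<otimes> coset_rep k (Suc k)" by (simp add: coset_rep_top)
    then show ?case
      using subgroup.one_closed[OF parabolic_subgroup[of k]] assms(1) by force
  next
    case (gen x i)
    then obtain y j where y: "y \<in> parabolic k" and j: "1 \<le> j" "j \<le> Suc k"
      and x: "x = y \<otimes> coset_rep k j"
      by auto
    have cl: "y \<in> carrier G" "r i \<in> carrier G" "coset_rep k j \<in> carrier G"
      using y assms(1) gen.hyps(2,3) j parabolic_closed[of k y]
      by (simp_all add: r_closed coset_rep_closed)
    have absorb: "\<exists>y\<in>parabolic k. \<exists>j\<in>{1..Suc k}. x \<otimes> r i = y \<otimes> coset_rep k j"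
      if "coset_rep k j \<otimes> r i = r i' \<otimes> coset_rep k j" "1 \<le> i'" "i' < k" for i'
    proof -
      have "r i' \<in> carrier G" using that assms(1) by (simp add: r_closed)
      then have "x \<otimes> r i = (y \<otimes> r i') \<otimes> coset_rep k j"
        using cl that x by (simp add: m_assoc)
      moreover have "y \<otimes> r i' \<in> parabolic k"
        using y that by (simp add: parabolic_mult parabolic_r)
      ultimately show ?thesis using j by (intro bexI[of _ "y \<otimes> r i'"] bexI[of _ j]) auto
    qed
    consider "Suc i < j" | "j = Suc i" | "j = i" | "j < i" by linarith
    then show ?case
    proof cases
      case 1
      then show ?thesis using absorb[of i] coset_rep_commute[of k j i] gen.hyps(2,3) j assms(1) by auto
    next
      case 2
      then have "x \<otimes> r i = y \<otimes> coset_rep k i"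
        using coset_rep_snoc[of k i] cl x gen.hyps(2,3) j assms(1) by (simp add: m_assoc)
      then show ?thesis using y gen.hyps(2,3) by (intro bexI[of _ y] bexI[of _ i]) auto
    next
      case 3
      have cl': "coset_rep k (Suc i) \<in> carrier G"
        using assms(1) by (simp add: coset_rep_closed)
      have "x \<otimes> r i = y \<otimes> (coset_rep k (Suc i) \<otimes> (r i \<otimes> r i))"
        using coset_rep_snoc[of k i] cl cl' x gen.hyps(2,3) assms(1) 3 by (simp add: m_assoc)
      also have "\<dots> = y \<otimes> coset_rep k (Suc i)"
        using cl' cl gen.hyps(2,3) assms(1) by (simp add: r_square)
      finally show ?thesis using y gen.hyps(2,3) by (intro bexI[of _ y] bexI[of _ "Suc i"]) auto
    next
      case 4
      then show ?thesis
        using absorb[of "i - 1"] coset_rep_shift[of k j "i - 1"] gen.hyps(2,3) j assms(1) by auto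
    qed
  qed
qed

lemma proj_coset_rep: "\<lbrakk>k < n; 1 \<le> j; j \<le> Suc k\<rbrakk> \<Longrightarrow> \<pi> (coset_rep k j) j = Suc k"
proof (induction k)
  case 0
  then show ?case by (simp add: proj_one)
next
  case (Suc k)
  then show ?case
    by (cases "j = Suc (Suc k)") (auto simp: proj_one proj_mult r_closed coset_rep_closed proj_r)
qed

text \<open>
  If \<open>y \<otimes> coset_rep k j\<close> has trivial permutation, then \<open>j\<close> is the preimage of \<open>Suc k\<close>, which the
  permutation of \<open>y \<in> parabolic k\<close> fixes. So \<open>j = Suc k\<close>, the representative is trivial, and the
  element already lies in \<open>parabolic k\<close>.
\<close>

lemma proj_faithful_parabolic:
  "\<lbrakk>k \<le> n; x \<in> parabolic k; \<pi> x = id\<rbrakk> \<Longrightarrow> x = \<one>"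
proof (induction k arbitrary: x)
  case 0
  then show ?case using generate_empty by (auto simp: parabolic_def)
next
  case (Suc k)
  then obtain y j where y: "y \<in> parabolic k" and j: "1 \<le> j" "j \<le> Suc k"
    and x: "x = y \<otimes> coset_rep k j"
    using parabolic_Suc_decomp[of k x] by auto
  have cl: "y \<in> carrier G" "coset_rep k j \<in> carrier G"
    using y j Suc.prems(1) parabolic_closed[of k y] by (auto simp: coset_rep_closed)
  have "j = \<pi> y (\<pi> (coset_rep k j) j)"
    using Suc.prems(3) cl x proj_mult[of y "coset_rep k j"] by (simp add: fun_eq_iff)
  also have "\<dots> = \<pi> y (Suc k)"
    using proj_coset_rep[of k j] j Suc.prems(1) by simp
  also have "\<dots> = Suc k"
    using permutes_not_in[OF proj_parabolic[of k y], of "Suc k"] y Suc.prems(1) by simp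
  finally have "x = y" using x cl by (simp add: coset_rep_top)
  then show ?case using Suc.IH[of x] Suc.prems y by simp
qed

lemma proj_onto_parabolic:
  "\<lbrakk>k \<le> n; p permutes {1..k}\<rbrakk> \<Longrightarrow> \<exists>x\<in>parabolic k. \<pi> x = p"
proof (induction k arbitrary: p)
  case 0
  then have "p = \<pi> \<one>" by (simp add: proj_one)
  then show ?case unfolding parabolic_def using generate.one by blast
next
  case (Suc k)
  have kn: "k < n" using Suc.prems by simp
  define j where "j = inv' p (Suc k)"
  have pj: "p j = Suc k" unfolding j_def by (rule permutes_inverses(1)[OF Suc.prems(2)])
  have "j \<in> {1..Suc k}"
    unfolding j_def permutes_in_image[OF permutes_inv[OF Suc.prems(2)]] by simp
  then have j: "1 \<le> j" "j \<le> Suc k" by auto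
  let ?c = "coset_rep k j"
  have cl: "?c \<in> carrier G" using j kn by (simp add: coset_rep_closed)
  have cP: "?c \<in> parabolic (Suc k)"
  proof -
    have "r ` {j..k} \<subseteq> r ` {1..<Suc k}" using j by (intro image_mono) auto
    then show ?thesis
      using coset_rep_in_generate[of k j] mono_generate unfolding parabolic_def by blast
  qed
  define q where "q = p \<circ> inv' (\<pi> ?c)"
  have cp: "\<pi> ?c permutes {1..Suc k}" using proj_parabolic cP Suc.prems by blast
  have "q permutes {1..Suc k}"
    unfolding q_def using Suc.prems cp by (intro permutes_compose permutes_inv)
  moreover have "q (Suc k) = Suc k"
    using proj_coset_rep[OF kn j] permutes_inverses(2)[OF cp, of j] pj by (simp add: q_def)
  moreover have "{1..Suc k} - {1..k} = {Suc k}" by auto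
  ultimately have "q permutes {1..k}"
    using permutes_superset[of q "{1..Suc k}" "{1..k}"] by simp
  then obtain y where y: "y \<in> parabolic k" "\<pi> y = q"
    using Suc.IH[of q] kn by auto
  have "\<pi> (y \<otimes> ?c) = p"
    using y cl parabolic_closed[of k y] kn permutes_inv_o(2)[OF cp]
    by (simp add: proj_mult q_def comp_assoc)
  moreover have "y \<otimes> ?c \<in> parabolic (Suc k)"
    using y cP parabolic_mono[of k "Suc k"] by (intro parabolic_mult) auto
  ultimately show ?case by blast
qed

text \<open>
  The section of \<open>\<pi>\<close>. A permutation that fixes the points above \<open>k\<close> is lifted into \<open>parabolic k\<close>, so
  its lift commutes with everything that commutes with \<open>r 1, \<dots>, r (k - 1)\<close>.
\<close>

definition lift :: "(nat \<Rightarrow> nat) \<Rightarrow> 'a" where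
  "lift p = inv_into (parabolic n) \<pi> p"

lemma proj_inj_parabolic: "inj_on \<pi> (parabolic n)"
proof (rule inj_onI)
  fix x y assume xy: "x \<in> parabolic n" "y \<in> parabolic n" "\<pi> x = \<pi> y"
  then have cl: "x \<in> carrier G" "y \<in> carrier G" using parabolic_closed by auto
  have "\<pi> (x \<otimes> inv y) = id"
    using cl xy(3) proj_permutes[OF cl(2)] by (simp add: proj_mult proj_inv permutes_inv_o)
  moreover have "x \<otimes> inv y \<in> parabolic n"
    using xy parabolic_subgroup[of n] by (simp add: subgroup.m_closed subgroup.m_inv_closed)
  ultimately have "x \<otimes> inv y = \<one>" using proj_faithful_parabolic by blast
  then have "inv (inv y) = x" using cl by (intro inv_equality) auto
  then show "x = y" using cl by simp
qed

lemma lift_proj: "x \<in> parabolic n \<Longrightarrow> lift (\<pi> x) = x"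
  unfolding lift_def by (simp add: inv_into_f_f proj_inj_parabolic)

lemma lift_in_parabolic:
  assumes "k \<le> n" "p permutes {1..k}"
  shows "lift p \<in> parabolic k"
proof -
  obtain x where "x \<in> parabolic k" "\<pi> x = p" using proj_onto_parabolic[OF assms] by blast
  moreover from this have "x \<in> parabolic n" using parabolic_mono[OF assms(1)] by blast
  ultimately show ?thesis using lift_proj[of x] by simp
qed

lemma lift_closed: "p permutes {1..n} \<Longrightarrow> lift p \<in> carrier G"
  using lift_in_parabolic[of n p] parabolic_closed[of n "lift p"] by simp

lemma proj_lift: "p permutes {1..n} \<Longrightarrow> \<pi> (lift p) = p"
  using proj_onto_parabolic[of n p] lift_proj by auto

lemma lift_mult:
  assumes "p permutes {1..n}" "q permutes {1..n}"
  shows "lift (p \<circ> q) = lift p \<otimes> lift q"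
proof -
  have "lift p \<otimes> lift q \<in> parabolic n"
    using assms by (intro parabolic_mult lift_in_parabolic) simp_all
  then show ?thesis
    using lift_proj[of "lift p \<otimes> lift q"] assms by (simp add: proj_mult lift_closed proj_lift)
qed

lemma lift_hom: "lift \<in> hom (sym_group n) G"
  by (intro homI) (simp_all add: sym_group_carrier sym_group_mult lift_closed lift_mult)

lemma lift_id: "lift id = \<one>"
  using lift_proj[of \<one>] by (simp add: proj_one parabolic_def generate.one)

lemma lift_r: "\<lbrakk>1 \<le> i; i < n\<rbrakk> \<Longrightarrow> lift (transpose i (Suc i)) = r i"
  using lift_proj[of "r i"] by (simp add: proj_r parabolic_r)

end

section \<open>Groups with virtual twin generators and an affine action\<close>

definition skew_unit :: "nat \<Rightarrow> nat \<Rightarrow> nat \<Rightarrow> nat \<Rightarrow> int" where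
  "skew_unit i j p q = of_bool (p = i \<and> q = j) - of_bool (p = j \<and> q = i)"

text \<open>
  Both the virtual twin group and its quotient by the commutator subgroup of the pure part are
  instances: \<open>r\<close> and \<open>t\<close> play the roles of \<open>\<rho>\<close> and \<open>\<sigma>\<close>, and \<open>\<Psi>\<close> is an affine action on integer
  functions of two arguments. Working in both instances with the same lemmas is what allows the
  action to be pushed down to the quotient.
\<close>

locale virtual_twin = adjacent_lifts +
  fixes t :: "nat \<Rightarrow> 'a" and \<Psi> :: "'a \<Rightarrow> (nat \<Rightarrow> nat \<Rightarrow> int) \<Rightarrow> nat \<Rightarrow> nat \<Rightarrow> int"
  assumes two_le: "2 \<le> n"
    and t_closed: "\<lbrakk>1 \<le> i; i < n\<rbrakk> \<Longrightarrow> t i \<in> carrier G"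
    and proj_t: "\<lbrakk>1 \<le> i; i < n\<rbrakk> \<Longrightarrow> \<pi> (t i) = transpose i (Suc i)"
    and t_square: "\<lbrakk>1 \<le> i; i < n\<rbrakk> \<Longrightarrow> t i \<otimes> t i = \<one>"
    and r_t_commute: "\<lbrakk>1 \<le> i; Suc i < j; j < n\<rbrakk> \<Longrightarrow> r i \<otimes> t j = t j \<otimes> r i"
    and r_t_mixed: "\<lbrakk>1 \<le> i; Suc i < n\<rbrakk> \<Longrightarrow> r i \<otimes> (r (Suc i) \<otimes> t i) = t (Suc i) \<otimes> (r i \<otimes> r (Suc i))"
    and generated: "carrier G = generate G (r ` {1..<n} \<union> t ` {1..<n})"
    and affine_hom: "\<Psi> \<in> hom G (BijGroup UNIV)"
    and affine_r: "\<lbrakk>1 \<le> i; i < n\<rbrakk> \<Longrightarrow>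
        \<Psi> (r i) f p q = f (transpose i (Suc i) p) (transpose i (Suc i) q)"
    and affine_t: "\<lbrakk>1 \<le> i; i < n\<rbrakk> \<Longrightarrow>
        \<Psi> (t i) f p q = f (transpose i (Suc i) p) (transpose i (Suc i) q) + skew_unit i (Suc i) p q"
begin

lemma t_inv: "\<lbrakk>1 \<le> i; i < n\<rbrakk> \<Longrightarrow> inv (t i) = t i"
  using inv_equality t_closed t_square by blast

lemma affine_mult: "\<lbrakk>x \<in> carrier G; y \<in> carrier G\<rbrakk> \<Longrightarrow> \<Psi> (x \<otimes> y) f = \<Psi> x (\<Psi> y f)"
  using hom_mult[OF affine_hom, of x y] hom_in_carrier[OF affine_hom, of x]
    hom_in_carrier[OF affine_hom, of y]
  by (simp add: BijGroup_def compose_def)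

lemma affine_one: "\<Psi> \<one> f = f"
proof -
  interpret \<Psi>: group_hom G "BijGroup UNIV" \<Psi>
    using affine_hom by (simp add: group_hom_def group_hom_axioms_def group_BijGroup)
  show ?thesis using \<Psi>.hom_one by (simp add: BijGroup_def)
qed

definition conj_lift :: "(nat \<Rightarrow> nat) \<Rightarrow> 'a \<Rightarrow> 'a" where
  "conj_lift w x = lift w \<otimes> x \<otimes> inv (lift w)"

lemma conj_lift_closed:
  "\<lbrakk>w permutes {1..n}; x \<in> carrier G\<rbrakk> \<Longrightarrow> conj_lift w x \<in> carrier G"
  by (simp add: conj_lift_def lift_closed)

lemma conj_lift_comp:
  "\<lbrakk>v permutes {1..n}; w permutes {1..n}; x \<in> carrier G\<rbrakk> \<Longrightarrow>
    conj_lift (v \<circ> w) x = conj_lift v (conj_lift w x)"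
  by (simp add: conj_lift_def lift_mult lift_closed m_assoc inv_mult_group)

lemma conj_lift_id: "x \<in> carrier G \<Longrightarrow> conj_lift id x = x"
  by (simp add: conj_lift_def lift_id)

lemma conj_lift_mult:
  assumes "w permutes {1..n}" "x \<in> carrier G" "y \<in> carrier G"
  shows "conj_lift w (x \<otimes> y) = conj_lift w x \<otimes> conj_lift w y"
proof -
  have "lift w \<in> carrier G" using assms(1) by (rule lift_closed)
  then have "inv (lift w) \<otimes> (lift w \<otimes> z) = z" if "z \<in> carrier G" for z
    using that by (simp add: m_assoc[symmetric])
  then show ?thesis using assms by (simp add: conj_lift_def lift_closed m_assoc)
qed

lemma conj_lift_one: "w permutes {1..n} \<Longrightarrow> conj_lift w \<one> = \<one>"
  by (simp add: conj_lift_def lift_closed)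

lemma conj_lift_inv:
  assumes "w permutes {1..n}" "x \<in> carrier G"
  shows "conj_lift w (inv x) = inv (conj_lift w x)"
  using assms by (simp add: conj_lift_def lift_closed m_assoc inv_mult_group)

lemma conj_lift_inj:
  assumes "w permutes {1..n}" "x \<in> carrier G" "y \<in> carrier G" "conj_lift w x = conj_lift w y"
  shows "x = y"
  using assms by (simp add: conj_lift_def lift_closed)

lemma conj_lift_eqI:
  assumes "w permutes {1..n}" "x \<in> carrier G" "y \<in> carrier G" "lift w \<otimes> x = y \<otimes> lift w"
  shows "conj_lift w x = y"
  using assms by (simp add: conj_lift_def lift_closed m_assoc)

text \<open>
  The pair \<open>(n - 1, n)\<close> serves as base point for the action of \<open>S\<^sub>n\<close> on ordered pairs of distinct
  points. Taking the last two points makes the stabilizer equal to the permutations of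
  \<open>1, \<dots>, n - 2\<close>, whose lifts form the parabolic subgroup \<open>parabolic (n - 2)\<close>.
\<close>

definition frame :: "(nat \<Rightarrow> nat) \<Rightarrow> nat \<Rightarrow> nat \<Rightarrow> bool" where
  "frame w i j \<longleftrightarrow> w permutes {1..n} \<and> w (n - 1) = i \<and> w n = j"

lemma frame_exists:
  assumes "i \<in> {1..n}" "j \<in> {1..n}" "i \<noteq> j"
  shows "\<exists>w. frame w i j"
proof -
  \<comment> \<open>First bring \<open>i\<close> to the place \<open>n - 1\<close>; the point that then has to go to \<open>n\<close> is \<open>?u j\<close>, and
    exchanging it with \<open>n\<close> leaves \<open>n - 1\<close> alone.\<close>
  let ?u = "transpose (n - 1) i"
  let ?w = "?u \<circ> transpose n (?u j)"
  have u: "?u permutes {1..n}" using assms two_le by (intro permutes_swap_id) auto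
  have "?u j \<in> {1..n}" using permutes_in_image[OF u] assms(2) by blast
  then have "transpose n (?u j) permutes {1..n}" using two_le by (intro permutes_swap_id) auto
  then have "?w permutes {1..n}" using u by (rule permutes_compose)
  moreover have "?w (n - 1) = i"
  proof -
    have "?u j \<noteq> n - 1" using assms(3) by (auto simp: transpose_def)
    then show ?thesis using two_le by simp
  qed
  moreover have "?w n = j" by simp
  ultimately show ?thesis unfolding frame_def by blast
qed

definition base :: 'a where
  "base = t (n - 1) \<otimes> r (n - 1)"

definition pure_gen :: "nat \<Rightarrow> nat \<Rightarrow> 'a" where
  "pure_gen i j = conj_lift (SOME w. frame w i j) base"

lemma base_closed: "base \<in> carrier G"
  using two_le by (simp add: base_def t_closed r_closed)

text \<open>
  The generators \<open>r i\<close> of \<open>parabolic (n - 2)\<close> have index at most \<open>n - 3\<close>, far from \<open>n - 1\<close>, so they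
  commute with both factors of \<open>base\<close>.
\<close>

lemma conj_lift_stabilizer:
  assumes "u permutes {1..n}" "u (n - 1) = n - 1" "u n = n"
  shows "conj_lift u base = base"
proof -
  have "{1..n} - {1..n - 2} = {n - 1, n}" using two_le by auto
  then have "u permutes {1..n - 2}"
    using permutes_superset[OF assms(1), of "{1..n - 2}"] assms(2,3) by auto
  then have lu: "lift u \<in> parabolic (n - 2)" by (intro lift_in_parabolic) simp_all
  have "base \<otimes> lift u = lift u \<otimes> base"
  proof (rule generate_commute[OF _ base_closed _ lu[unfolded parabolic_def]])
    show "r ` {1..<n - 2} \<subseteq> carrier G" by (auto simp: r_closed)
    fix s assume "s \<in> r ` {1..<n - 2}"
    then obtain i where i: "s = r i" "1 \<le> i" "Suc i < n - 1" by auto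
    have cl: "r i \<in> carrier G" "r (n - 1) \<in> carrier G" "t (n - 1) \<in> carrier G"
      using i by (simp_all add: r_closed t_closed)
    have "base \<otimes> r i = t (n - 1) \<otimes> (r i \<otimes> r (n - 1))"
      using cl i r_commute[of i "n - 1"] by (simp add: base_def m_assoc)
    also have "\<dots> = r i \<otimes> t (n - 1) \<otimes> r (n - 1)"
      using cl i r_t_commute[of i "n - 1"] by (simp add: m_assoc)
    finally show "base \<otimes> s = s \<otimes> base" using cl i(1) by (simp add: base_def m_assoc)
  qed
  then show ?thesis using assms(1) base_closed by (intro conj_lift_eqI) simp_all
qed

text \<open>
  Two frames for the same pair differ by an element of the stabilizer, so the choice made in the
  definition of \<open>pure_gen\<close> does not matter.
\<close>

lemma conj_lift_base:
  assumes "frame w i j"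
  shows "conj_lift w base = pure_gen i j"
proof -
  define v where "v = (SOME w. frame w i j)"
  have v: "frame v i j" unfolding v_def using assms by (rule someI[of "\<lambda>w. frame w i j"])
  have vp: "v permutes {1..n}" and wp: "w permutes {1..n}"
    using v assms by (simp_all add: frame_def)
  have "(inv' v \<circ> w) (n - 1) = n - 1" "(inv' v \<circ> w) n = n"
    using v assms permutes_inverses(2)[OF vp] by (auto simp: frame_def)
  moreover have up: "inv' v \<circ> w permutes {1..n}"
    using vp wp by (intro permutes_compose permutes_inv)
  ultimately have "conj_lift (inv' v \<circ> w) base = base"
    by (intro conj_lift_stabilizer)
  moreover have "w = v \<circ> (inv' v \<circ> w)"
    using permutes_inv_o(1)[OF vp] by (simp add: comp_assoc[symmetric])
  ultimately have "conj_lift w base = conj_lift v base"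
    using conj_lift_comp[OF vp up base_closed] by simp
  then show ?thesis by (simp add: pure_gen_def v_def)
qed

lemma pure_gen_closed: "\<lbrakk>i \<in> {1..n}; j \<in> {1..n}; i \<noteq> j\<rbrakk> \<Longrightarrow> pure_gen i j \<in> carrier G"
  by (metis frame_exists conj_lift_base conj_lift_closed base_closed frame_def)

lemma conj_lift_pure_gen:
  assumes "w permutes {1..n}" "i \<in> {1..n}" "j \<in> {1..n}" "i \<noteq> j"
  shows "conj_lift w (pure_gen i j) = pure_gen (w i) (w j)"
proof -
  obtain v where v: "frame v i j" using frame_exists[OF assms(2-4)] by blast
  then have "frame (w \<circ> v) (w i) (w j)"
    using assms(1) by (simp add: frame_def permutes_compose del: o_apply) (simp add: o_def)
  from conj_lift_base[OF this] show ?thesis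
    using v assms(1) conj_lift_base[OF v] conj_lift_comp[of w v base]
    by (simp add: base_closed frame_def)
qed

text \<open>
  Conjugating \<open>t \<otimes> r\<close> by the involution \<open>r\<close> gives \<open>r \<otimes> t\<close>, which is its inverse as \<open>t\<close> is an
  involution too.
\<close>

lemma pure_gen_swap:
  assumes "i \<in> {1..n}" "j \<in> {1..n}" "i \<noteq> j"
  shows "pure_gen j i = inv (pure_gen i j)"
proof -
  let ?s = "transpose (n - 1) n" and ?t = "t (n - 1)" and ?r = "r (n - 1)"
  obtain w where w: "frame w i j" using frame_exists[OF assms] by blast
  then have wp: "w permutes {1..n}" by (simp add: frame_def)
  have sp: "?s permutes {1..n}" using two_le by (intro permutes_swap_id) auto
  have base: "base = ?t \<otimes> ?r" by (simp add: base_def)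
  have "Suc (n - 1) = n" using two_le by simp
  then have ls: "lift ?s = ?r" using lift_r[of "n - 1"] two_le by simp
  have cl: "?t \<in> carrier G" "?r \<in> carrier G" using two_le by (simp_all add: t_closed r_closed)
  have "frame (w \<circ> ?s) j i"
    using w permutes_compose[OF sp wp] by (simp add: frame_def)
  then have "pure_gen j i = conj_lift (w \<circ> ?s) base" by (rule conj_lift_base[symmetric])
  also have "\<dots> = conj_lift w (conj_lift ?s base)"
    using sp wp base_closed by (intro conj_lift_comp)
  also have "conj_lift ?s base = ?r \<otimes> ?t"
    using sp cl base_closed by (intro conj_lift_eqI) (simp_all only: ls base m_assoc m_closed)
  also have "?r \<otimes> ?t = inv base"
    unfolding base using cl two_le r_inv[of "n - 1"] t_inv[of "n - 1"] by (simp add: inv_mult_group)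
  also have "conj_lift w (inv base) = inv (pure_gen i j)"
    using conj_lift_inv[OF wp base_closed] conj_lift_base[OF w] by simp
  finally show ?thesis .
qed

text \<open>
  Descending induction from \<open>i = n - 1\<close>: by the braid and the mixed relation, conjugation by
  \<open>r i \<otimes> r (Suc i)\<close> takes \<open>t i \<otimes> r i\<close> to \<open>t (Suc i) \<otimes> r (Suc i)\<close>, and its permutation takes the
  pair \<open>(i, i + 1)\<close> to \<open>(i + 1, i + 2)\<close>.
\<close>

lemma pure_gen_adjacent:
  assumes "1 \<le> i" "i < n"
  shows "pure_gen i (Suc i) = t i \<otimes> r i"
proof -
  have "i \<le> n - 1" using assms by simp
  then show ?thesis using assms(1)
  proof (induction rule: inc_induct)
    case base
    have "frame id (n - 1) (Suc (n - 1))" using two_le permutes_id by (simp add: frame_def)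
    then show ?case
      using conj_lift_base[of id] conj_lift_id[OF base_closed] by (simp add: base_def)
  next
    case (step i)
    then have i: "1 \<le> i" "Suc i < n" "i < n" by auto
    define v where "v = transpose i (Suc i) \<circ> transpose (Suc i) (Suc (Suc i))"
    have p: "transpose i (Suc i) permutes {1..n}" "transpose (Suc i) (Suc (Suc i)) permutes {1..n}"
      using i by (auto intro!: permutes_swap_id)
    then have vp: "v permutes {1..n}" unfolding v_def by (intro permutes_compose)
    have lv: "lift v = r i \<otimes> r (Suc i)"
      using i p by (simp add: v_def lift_mult lift_r)
    have cl: "r i \<in> carrier G" "r (Suc i) \<in> carrier G" "t i \<in> carrier G" "t (Suc i) \<in> carrier G"
      using i by (simp_all add: r_closed t_closed)
    have v: "v i = Suc i" "v (Suc i) = Suc (Suc i)" by (simp_all add: v_def transpose_def)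
    have ij: "i \<in> {1..n}" "Suc i \<in> {1..n}" "i \<noteq> Suc i" using i by auto
    have "lift v \<otimes> (t i \<otimes> r i) = t (Suc i) \<otimes> (r i \<otimes> r (Suc i)) \<otimes> r i"
      using cl i r_t_mixed[of i] by (simp add: lv m_assoc[symmetric])
    also have "\<dots> = t (Suc i) \<otimes> (r (Suc i) \<otimes> (r i \<otimes> r (Suc i)))"
      using cl i r_braid[of i] by (simp add: m_assoc)
    also have "\<dots> = t (Suc i) \<otimes> r (Suc i) \<otimes> lift v"
      using cl by (simp add: lv m_assoc)
    finally have "conj_lift v (t i \<otimes> r i) = t (Suc i) \<otimes> r (Suc i)"
      using vp cl by (intro conj_lift_eqI) simp_all
    also have "\<dots> = conj_lift v (pure_gen i (Suc i))"
      using step.IH i conj_lift_pure_gen[OF vp ij] by (simp add: v)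
    finally show ?case
      using conj_lift_inj[OF vp, of "t i \<otimes> r i" "pure_gen i (Suc i)"] cl pure_gen_closed[OF ij] by simp
  qed
qed

lemma proj_pure_gen:
  assumes "i \<in> {1..n}" "j \<in> {1..n}" "i \<noteq> j"
  shows "\<pi> (pure_gen i j) = id"
proof -
  obtain w where w: "frame w i j" using frame_exists[OF assms] by blast
  then have wp: "w permutes {1..n}" by (simp add: frame_def)
  have "\<pi> base = id"
    using two_le by (simp add: base_def proj_mult proj_t proj_r t_closed r_closed)
  then have "\<pi> (conj_lift w base) = id"
    using lift_closed[OF wp] base_closed permutes_inv_o(1)[OF wp]
    by (simp only: conj_lift_def proj_mult m_closed inv_closed proj_inv proj_lift[OF wp] o_id)
  then show ?thesis using conj_lift_base[OF w] by simp
qed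

definition pure_gens :: "'a set" where
  "pure_gens = {pure_gen i j | i j. i \<in> {1..n} \<and> j \<in> {1..n} \<and> i \<noteq> j}"

lemma pure_gens_closed: "pure_gens \<subseteq> carrier G"
  unfolding pure_gens_def using pure_gen_closed by blast

lemma conj_lift_generate_pure_gens:
  assumes w: "w permutes {1..n}" and "x \<in> generate G pure_gens"
  shows "conj_lift w x \<in> generate G pure_gens"
  using assms(2)
proof (induction rule: generate.induct)
  case one
  then show ?case using w by (simp add: conj_lift_one generate.one)
next
  case (incl h)
  then obtain i j where h: "h = pure_gen i j" "i \<in> {1..n}" "j \<in> {1..n}" "i \<noteq> j"
    unfolding pure_gens_def by blast
  have "w i \<in> {1..n}" "w j \<in> {1..n}" "w i \<noteq> w j"
    using h permutes_in_image[OF w] permutes_inj[OF w] by (auto dest: injD)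
  then have "conj_lift w h \<in> pure_gens" unfolding pure_gens_def using conj_lift_pure_gen[OF w] h by blast
  then show ?case by (rule generate.incl)
next
  case (inv h)
  then obtain i j where h: "h = pure_gen i j" "i \<in> {1..n}" "j \<in> {1..n}" "i \<noteq> j"
    unfolding pure_gens_def by blast
  have "w i \<in> {1..n}" "w j \<in> {1..n}" "w i \<noteq> w j"
    using h permutes_in_image[OF w] permutes_inj[OF w] by (auto dest: injD)
  then have "conj_lift w h \<in> pure_gens" unfolding pure_gens_def using conj_lift_pure_gen[OF w] h by blast
  then show ?case using w h pure_gen_closed by (simp add: conj_lift_inv generate.inv)
next
  case (eng h1 h2)
  then show ?case
    using w generate_in_carrier[OF pure_gens_closed]
    by (simp add: conj_lift_mult generate.eng)
qed

text \<open>
  The first factor of \<open>x\<close> in the semidirect decomposition of the group given by the section. It is a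
  crossed homomorphism, so its values lie in any subgroup that is stable under the section and
  contains the values at the generators, which are \<open>\<one>\<close> and \<open>pure_gen i (Suc i)\<close>.
\<close>

definition pure_part :: "'a \<Rightarrow> 'a" where
  "pure_part x = x \<otimes> inv (lift (\<pi> x))"

lemma pure_part_mult:
  assumes "x \<in> carrier G" "y \<in> carrier G"
  shows "pure_part (x \<otimes> y) = pure_part x \<otimes> conj_lift (\<pi> x) (pure_part y)"
proof -
  have p: "\<pi> x permutes {1..n}" "\<pi> y permutes {1..n}" using assms proj_permutes by auto
  then have cl: "lift (\<pi> x) \<in> carrier G" "lift (\<pi> y) \<in> carrier G" by (auto simp: lift_closed)
  then have "inv (lift (\<pi> x)) \<otimes> (lift (\<pi> x) \<otimes> z) = z" if "z \<in> carrier G" for z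
    using that by (simp add: m_assoc[symmetric])
  then show ?thesis
    using assms p cl by (simp add: pure_part_def conj_lift_def proj_mult lift_mult m_assoc inv_mult_group)
qed

lemma pure_part_in_generate_pure_gens:
  assumes "x \<in> carrier G"
  shows "pure_part x \<in> generate G pure_gens"
proof -
  have gen: "pure_part h \<in> generate G pure_gens" if "h \<in> r ` {1..<n} \<union> t ` {1..<n}" for h
  proof -
    from that consider i where "h = r i" "1 \<le> i" "i < n" | i where "h = t i" "1 \<le> i" "i < n" by auto
    then show ?thesis
    proof cases
      case 1
      then have "pure_part h = \<one>" by (simp add: pure_part_def proj_r lift_r r_closed)
      then show ?thesis by (simp add: generate.one)
    next
      case 2
      then have "pure_part h = pure_gen i (Suc i)"
        by (simp add: pure_part_def proj_t lift_r r_inv pure_gen_adjacent)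
      moreover have "pure_gen i (Suc i) \<in> pure_gens"
        unfolding pure_gens_def using 2(2,3) by (intro CollectI exI[of _ i] exI[of _ "Suc i"]) auto
      ultimately show ?thesis by (simp add: generate.incl)
    qed
  qed
  have inv_gen: "inv h = h" if "h \<in> r ` {1..<n} \<union> t ` {1..<n}" for h
    using that by (auto simp: r_inv t_inv)
  from assms show ?thesis
    unfolding generated
  proof (induction rule: generate.induct)
    case one
    then show ?case by (simp add: pure_part_def proj_one lift_id generate.one)
  next
    case (incl h)
    then show ?case by (rule gen)
  next
    case (inv h)
    then show ?case using gen inv_gen by simp
  next
    case (eng h1 h2)
    then have cl: "h1 \<in> carrier G" "h2 \<in> carrier G" by (simp_all add: generated)
    show ?case
      unfolding pure_part_mult[OF cl]
      using eng.IH conj_lift_generate_pure_gens[OF proj_permutes[OF cl(1)]] by (intro generate.eng)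
  qed
qed

lemma kernel_in_generate_pure_gens:
  assumes "x \<in> carrier G" "\<pi> x = id"
  shows "x \<in> generate G pure_gens"
  using pure_part_in_generate_pure_gens[OF assms(1)] assms by (simp add: pure_part_def lift_id)

text \<open>
  For an element with trivial permutation this function determines the whole action, see
  \<open>affine_kernel\<close>; for other elements it is the translation part of an affine map.
\<close>

definition translation :: "'a \<Rightarrow> nat \<Rightarrow> nat \<Rightarrow> int" where
  "translation x = \<Psi> x (\<lambda>_ _. 0)"

text \<open>
  Affinity of the action: up to the permutation of the arguments, the action of \<open>x\<close> changes \<open>f\<close> by a
  summand that is independent of \<open>f\<close>. This holds for the generators and is inherited by products.
\<close>

lemma affine_difference:
  assumes "x \<in> carrier G"
  shows "\<Psi> x f (\<pi> x p) (\<pi> x q) - f p q = \<Psi> x g (\<pi> x p) (\<pi> x q) - g p q"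
proof -
  have gen: "\<Psi> h f (\<pi> h p) (\<pi> h q) - f p q = \<Psi> h g (\<pi> h p) (\<pi> h q) - g p q"
    if "h \<in> r ` {1..<n} \<union> t ` {1..<n}" for h f g p q
    using that by (auto simp: proj_r proj_t affine_r affine_t)
  have inv_gen: "inv h = h" if "h \<in> r ` {1..<n} \<union> t ` {1..<n}" for h
    using that by (auto simp: r_inv t_inv)
  from assms show ?thesis
    unfolding generated
  proof (induction arbitrary: f g p q rule: generate.induct)
    case one
    then show ?case by (simp add: affine_one proj_one)
  next
    case (incl h)
    then show ?case by (rule gen)
  next
    case (inv h)
    then show ?case using gen[OF inv.hyps] inv_gen[OF inv.hyps] by simp
  next
    case (eng h1 h2)
    then have cl: "h1 \<in> carrier G" "h2 \<in> carrier G" by (simp_all add: generated)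
    show ?case
      using eng.IH(1)[of "\<Psi> h2 f" "\<pi> h2 p" "\<pi> h2 q" "\<Psi> h2 g"] eng.IH(2)[of f p q g]
      by (simp add: affine_mult[OF cl] proj_mult[OF cl])
  qed
qed

lemma affine_kernel:
  assumes "x \<in> carrier G" "\<pi> x = id"
  shows "\<Psi> x f p q = f p q + translation x p q"
  using affine_difference[OF assms(1), of f p q "\<lambda>_ _. 0"] assms(2) by (simp add: translation_def)

lemma translation_mult:
  assumes "x \<in> carrier G" "\<pi> x = id" "y \<in> carrier G"
  shows "translation (x \<otimes> y) p q = translation x p q + translation y p q"
  using affine_kernel[OF assms(1,2), of "\<Psi> y (\<lambda>_ _. 0)" p q] affine_mult[OF assms(1,3)]
  by (simp add: translation_def)

text \<open>
  Elements of the section are products of the \<open>r i\<close>, so they act without a translation part.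
\<close>

lemma affine_parabolic:
  assumes "x \<in> parabolic n"
  shows "\<Psi> x f (\<pi> x p) (\<pi> x q) = f p q"
  using le_refl assms
proof (induction arbitrary: f p q rule: parabolic_induct)
  case one
  then show ?case by (simp add: affine_one proj_one)
next
  case (gen x i)
  have x: "x \<in> carrier G" using parabolic_closed[OF le_refl gen.hyps(1)] .
  have "\<Psi> (x \<otimes> r i) f (\<pi> (x \<otimes> r i) p) (\<pi> (x \<otimes> r i) q) =
      \<Psi> x (\<Psi> (r i) f) (\<pi> x (transpose i (Suc i) p)) (\<pi> x (transpose i (Suc i) q))"
    using x gen.hyps(2,3) by (simp add: affine_mult proj_mult proj_r r_closed)
  also have "\<dots> = \<Psi> (r i) f (transpose i (Suc i) p) (transpose i (Suc i) q)"
    by (rule gen.IH)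
  finally show ?case using gen.hyps(2,3) by (simp add: affine_r)
qed

text \<open>
  The base element \<open>t (n - 1) \<otimes> r (n - 1)\<close> translates by the skew unit of \<open>(n - 1, n)\<close>, and
  conjugation by a lift transports the translation along the permutation.
\<close>

lemma translation_pure_gen:
  assumes "i \<in> {1..n}" "j \<in> {1..n}" "i \<noteq> j"
  shows "translation (pure_gen i j) = skew_unit i j"
proof (intro ext)
  fix p' q'
  let ?z = "\<lambda>_ _. 0 :: int"
  obtain w where w: "frame w i j" using frame_exists[OF assms] by blast
  then have wp: "w permutes {1..n}" and wij: "w (n - 1) = i" "w n = j" by (simp_all add: frame_def)
  obtain p q where pq: "p' = w p" "q' = w q" using permutes_surj[OF wp] by (metis surjD)
  have cl: "lift w \<in> carrier G" "pure_gen i j \<in> carrier G" using lift_closed[OF wp] pure_gen_closed[OF assms] by auto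
  have lw: "\<Psi> (lift w) f (w p) (w q) = f p q" for f
    using affine_parabolic[OF lift_in_parabolic[OF le_refl wp]] by (simp add: proj_lift[OF wp])
  have "pure_gen i j \<otimes> lift w = lift w \<otimes> base"
    unfolding conj_lift_base[OF w, symmetric] conj_lift_def using cl(1) base_closed by (simp add: m_assoc)
  then have "\<Psi> (pure_gen i j) (\<Psi> (lift w) ?z) (w p) (w q) = \<Psi> (lift w) (\<Psi> base ?z) (w p) (w q)"
    using cl base_closed by (metis affine_mult)
  then have "translation (pure_gen i j) (w p) (w q) = \<Psi> base ?z p q"
    by (simp add: affine_kernel[OF cl(2) proj_pure_gen[OF assms]] lw)
  also have "\<dots> = skew_unit (n - 1) n p q"
    using two_le by (simp add: base_def affine_mult t_closed r_closed affine_t affine_r)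
  also have "\<dots> = skew_unit i j (w p) (w q)"
    unfolding wij[symmetric] skew_unit_def using permutes_inj[OF wp] by (simp add: inj_eq)
  finally show "translation (pure_gen i j) p' q' = skew_unit i j p' q'" by (simp add: pq)
qed

end

context virtual_twin
begin

text \<open>
  Translations commute, so the commutators of elements with trivial permutation act trivially.
\<close>

lemma affine_kernel_commute:
  assumes "x \<in> carrier G" "\<pi> x = id" "y \<in> carrier G" "\<pi> y = id"
  shows "\<Psi> (x \<otimes> y) = \<Psi> (y \<otimes> x)"
proof (intro ext)
  fix f p q
  show "\<Psi> (x \<otimes> y) f p q = \<Psi> (y \<otimes> x) f p q"
    by (simp add: affine_mult assms(1,3) affine_kernel[OF assms(1,2)] affine_kernel[OF assms(3,4)])
qed

text \<open>
  Relations and generation pass to every quotient, so only the two homomorphisms have to descend.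
\<close>

lemma quotient_virtual_twin:
  assumes N: "N \<lhd> G"
    and \<pi>': "\<pi>' \<in> hom (G Mod N) (sym_group n)" "\<And>x. x \<in> carrier G \<Longrightarrow> \<pi>' (N #> x) = \<pi> x"
    and \<Psi>': "\<Psi>' \<in> hom (G Mod N) (BijGroup UNIV)" "\<And>x. x \<in> carrier G \<Longrightarrow> \<Psi>' (N #> x) = \<Psi> x"
  shows "virtual_twin (G Mod N) n \<pi>' (\<lambda>i. N #> r i) (\<lambda>i. N #> t i) \<Psi>'"
proof -
  interpret N: normal N G by fact
  interpret Q: group "G Mod N" by (rule N.factorgroup_is_group)
  interpret q: group_hom G "G Mod N" "\<lambda>x. N #> x"
    using N.r_coset_hom_Mod by unfold_locales
  show ?thesis
  proof unfold_locales
    show "\<pi>' \<in> hom (G Mod N) (sym_group n)" "\<Psi>' \<in> hom (G Mod N) (BijGroup UNIV)" by fact+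
    show "2 \<le> n" by (rule two_le)
    let ?S = "r ` {1..<n} \<union> t ` {1..<n}"
    have S: "?S \<subseteq> carrier G" by (auto simp: r_closed t_closed)
    have "(\<lambda>x. N #> x) ` carrier G = generate (G Mod N) ((\<lambda>x. N #> x) ` ?S)"
      using q.generate_img[OF S] generated by simp
    then show "carrier (G Mod N) = generate (G Mod N) ((\<lambda>i. N #> r i) ` {1..<n} \<union> (\<lambda>i. N #> t i) ` {1..<n})"
      by (simp add: carrier_FactGroup image_Un image_image)
    fix i :: nat assume i: "1 \<le> i"
    {
      assume "i < n"
      note cl = r_closed[OF i this] t_closed[OF i this]
      show "N #> r i \<in> carrier (G Mod N)" "N #> t i \<in> carrier (G Mod N)"
        using cl q.hom_closed by blast+
      show "\<pi>' (N #> r i) = transpose i (Suc i)" "\<pi>' (N #> t i) = transpose i (Suc i)"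
        using cl \<pi>'(2) proj_r[OF i \<open>i < n\<close>] proj_t[OF i \<open>i < n\<close>] by simp_all
      show "(N #> r i) \<otimes>\<^bsub>G Mod N\<^esub> (N #> r i) = \<one>\<^bsub>G Mod N\<^esub>"
        "(N #> t i) \<otimes>\<^bsub>G Mod N\<^esub> (N #> t i) = \<one>\<^bsub>G Mod N\<^esub>"
        using cl r_square[OF i \<open>i < n\<close>] t_square[OF i \<open>i < n\<close>]
        by (simp_all only: q.hom_mult[symmetric] q.hom_one)
      show "\<Psi>' (N #> r i) f p q = f (transpose i (Suc i) p) (transpose i (Suc i) q)" for f p q
        using cl \<Psi>'(2) affine_r[OF i \<open>i < n\<close>] by simp
      show "\<Psi>' (N #> t i) f p q =
          f (transpose i (Suc i) p) (transpose i (Suc i) q) + skew_unit i (Suc i) p q" for f p q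
        using cl \<Psi>'(2) affine_t[OF i \<open>i < n\<close>] by simp
    }
    {
      fix j assume j: "Suc i < j" "j < n"
      have cl: "r i \<in> carrier G" "r j \<in> carrier G" "t j \<in> carrier G"
        using i j by (simp_all add: r_closed t_closed)
      show "(N #> r i) \<otimes>\<^bsub>G Mod N\<^esub> (N #> r j) = (N #> r j) \<otimes>\<^bsub>G Mod N\<^esub> (N #> r i)"
        "(N #> r i) \<otimes>\<^bsub>G Mod N\<^esub> (N #> t j) = (N #> t j) \<otimes>\<^bsub>G Mod N\<^esub> (N #> r i)"
        using cl r_commute[OF i j] r_t_commute[OF i j] by (simp_all only: q.hom_mult[symmetric])
    }
    {
      assume n: "Suc i < n"
      have cl: "r i \<in> carrier G" "r (Suc i) \<in> carrier G" "t i \<in> carrier G" "t (Suc i) \<in> carrier G"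
        using i n by (simp_all add: r_closed t_closed)
      show "(N #> r i) \<otimes>\<^bsub>G Mod N\<^esub> ((N #> r (Suc i)) \<otimes>\<^bsub>G Mod N\<^esub> (N #> r i)) =
          (N #> r (Suc i)) \<otimes>\<^bsub>G Mod N\<^esub> ((N #> r i) \<otimes>\<^bsub>G Mod N\<^esub> (N #> r (Suc i)))"
        "(N #> r i) \<otimes>\<^bsub>G Mod N\<^esub> ((N #> r (Suc i)) \<otimes>\<^bsub>G Mod N\<^esub> (N #> t i)) =
          (N #> t (Suc i)) \<otimes>\<^bsub>G Mod N\<^esub> ((N #> r i) \<otimes>\<^bsub>G Mod N\<^esub> (N #> r (Suc i)))"
        using cl r_braid[OF i n] r_t_mixed[OF i n]
        by (simp_all only: q.hom_mult[symmetric] m_closed)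
    }
  qed
qed

end

section \<open>Abelian kernels are free on the pure generators\<close>

definition index_pairs :: "nat \<Rightarrow> (nat \<times> nat) set" where
  "index_pairs n = {(i, j). 1 \<le> i \<and> i < j \<and> j \<le> n}"

lemma card_index_pairs: "finite (index_pairs n)" "card (index_pairs n) = n * (n - 1) div 2"
proof -
  have eq: "index_pairs n = prod.swap ` (SIGMA j:{1..n}. {1..<j})"
    unfolding index_pairs_def by force
  show "finite (index_pairs n)" unfolding eq by simp
  have "card (index_pairs n) = card (SIGMA j:{1..n}. {1..<j})"
    unfolding eq by (rule card_image) simp
  also have "\<dots> = (\<Sum>j=1..n. j - 1)" by simp
  also have "\<dots> = n * (n - 1) div 2"
  proof (induction n)
    case (Suc n)
    then show ?case by (cases n) simp_all
  qed simp
  finally show "card (index_pairs n) = n * (n - 1) div 2" .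
qed

text \<open>
  The enumeration \<open>b\<close> of the pairs \<open>i < j\<close> turns exponent vectors on \<open>{..<m}\<close> into exponents of the
  elements \<open>pure_gen i j\<close>.
\<close>

locale virtual_twin_abelian = virtual_twin +
  fixes b :: "nat \<Rightarrow> nat \<times> nat" and m :: nat
  assumes kernel_commute: "\<lbrakk>x \<in> carrier G; y \<in> carrier G; \<pi> x = id; \<pi> y = id\<rbrakk> \<Longrightarrow> x \<otimes> y = y \<otimes> x"
    and enum: "bij_betw b {..<m} (index_pairs n)"
begin

definition pure_group :: "('a, 'b) monoid_scheme" where
  "pure_group = G\<lparr>carrier := kernel G (sym_group n) \<pi>\<rparr>"

lemma mem_pure_group: "x \<in> carrier pure_group \<longleftrightarrow> x \<in> carrier G \<and> \<pi> x = id"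
  by (simp add: pure_group_def kernel_def sym_group_one)

lemma mult_pure_group: "x \<otimes>\<^bsub>pure_group\<^esub> y = x \<otimes> y" and one_pure_group: "\<one>\<^bsub>pure_group\<^esub> = \<one>"
  by (simp_all add: pure_group_def)

lemma comm_group_pure_group: "comm_group pure_group"
proof -
  have "group pure_group"
    unfolding pure_group_def
    by (intro subgroup_imp_group group_hom.subgroup_kernel[OF proj_group_hom])
  then show ?thesis
    by (rule group.group_comm_groupI)
      (simp add: mem_pure_group mult_pure_group kernel_commute)
qed

sublocale pure: comm_group pure_group by (rule comm_group_pure_group)

lemma translation_hom: "(\<lambda>x. translation x p q) \<in> hom pure_group integer_group"
  by (rule homI) (simp_all add: mem_pure_group mult_pure_group translation_mult)

definition lattice_emb :: "(nat \<Rightarrow> int) \<Rightarrow> 'a" where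
  "lattice_emb c = finprod pure_group (\<lambda>k. pure_gen (fst (b k)) (snd (b k)) [^]\<^bsub>pure_group\<^esub> c k) {..<m}"

lemma enum_pair:
  assumes "k < m"
  shows "fst (b k) \<in> {1..n}" "snd (b k) \<in> {1..n}" "fst (b k) < snd (b k)"
proof -
  have "b k \<in> index_pairs n" using bij_betwE[OF enum] assms by simp
  then show "fst (b k) \<in> {1..n}" "snd (b k) \<in> {1..n}" "fst (b k) < snd (b k)"
    by (auto simp: index_pairs_def)
qed

lemma pure_gen_pure: "k < m \<Longrightarrow> pure_gen (fst (b k)) (snd (b k)) \<in> carrier pure_group"
  using enum_pair[of k] by (simp add: mem_pure_group pure_gen_closed proj_pure_gen del: atLeastAtMost_iff)

lemma lattice_emb_closed: "lattice_emb c \<in> carrier pure_group"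
  unfolding lattice_emb_def by (intro pure.finprod_closed) (auto simp: pure_gen_pure)

lemma lattice_emb_hom: "lattice_emb \<in> hom (int_power_group m) G"
proof (rule homI)
  show "lattice_emb c \<in> carrier G" for c using lattice_emb_closed by (simp add: mem_pure_group)
  fix c d
  have "lattice_emb (c \<otimes>\<^bsub>int_power_group m\<^esub> d) =
      finprod pure_group (\<lambda>k. pure_gen (fst (b k)) (snd (b k)) [^]\<^bsub>pure_group\<^esub> c k \<otimes>\<^bsub>pure_group\<^esub>
        pure_gen (fst (b k)) (snd (b k)) [^]\<^bsub>pure_group\<^esub> d k) {..<m}"
    unfolding lattice_emb_def
    by (intro pure.finprod_cong') (auto simp: int_power_group_def pure_gen_pure pure.int_pow_mult)
  also have "\<dots> = lattice_emb c \<otimes>\<^bsub>pure_group\<^esub> lattice_emb d"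
    unfolding lattice_emb_def by (intro pure.finprod_multf) (auto simp: pure_gen_pure)
  finally show "lattice_emb (c \<otimes>\<^bsub>int_power_group m\<^esub> d) = lattice_emb c \<otimes> lattice_emb d"
    by (simp add: mult_pure_group)
qed

lemma translation_finprod:
  assumes "finite A" "\<And>k. k \<in> A \<Longrightarrow> F k \<in> carrier pure_group"
  shows "translation (finprod pure_group F A) p q = (\<Sum>k\<in>A. translation (F k) p q)"
  using assms
proof (induction A rule: finite_induct)
  case empty
  then show ?case by (simp add: one_pure_group translation_def affine_one)
next
  case (insert k A)
  then have "finprod pure_group F (insert k A) = F k \<otimes>\<^bsub>pure_group\<^esub> (finprod pure_group F A)"
    by (intro pure.finprod_insert) auto
  moreover have "(finprod pure_group F A) \<in> carrier pure_group"
    using insert.prems by (intro pure.finprod_closed) auto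
  ultimately show ?case
    using insert hom_mult[OF translation_hom[of p q]] by simp
qed

lemma translation_int_pow:
  assumes "x \<in> carrier pure_group"
  shows "translation (x [^]\<^bsub>pure_group\<^esub> (z :: int)) p q = z * translation x p q"
  using hom_int_pow[OF translation_hom assms pure.is_group group_integer_group] by simp

lemma translation_enum:
  "k < m \<Longrightarrow> translation (pure_gen (fst (b k)) (snd (b k))) = skew_unit (fst (b k)) (snd (b k))"
  using translation_pure_gen[OF enum_pair(1,2)] enum_pair(3)[of k] by simp

text \<open>
  The coordinates are recovered from the translation: at a pair \<open>i < j\<close> only the skew unit of that very
  pair is nonzero, the reversed pair not being enumerated. This is the independence of the
  pure generators.
\<close>

lemma translation_lattice_emb:
  assumes "k < m"
  shows "translation (lattice_emb c) (fst (b k)) (snd (b k)) = c k"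
proof -
  have "translation (lattice_emb c) (fst (b k)) (snd (b k)) =
      (\<Sum>l<m. c l * skew_unit (fst (b l)) (snd (b l)) (fst (b k)) (snd (b k)))"
    unfolding lattice_emb_def
    by (subst translation_finprod) (simp_all add: pure_gen_pure translation_int_pow translation_enum)
  also have "\<dots> = (\<Sum>l<m. if l = k then c l else 0)"
  proof (intro sum.cong HOL.refl)
    fix l assume l: "l \<in> {..<m}"
    have "b l = b k \<longleftrightarrow> l = k"
      using inj_onD[OF bij_betw_imp_inj_on[OF enum]] l assms by auto
    then show "c l * skew_unit (fst (b l)) (snd (b l)) (fst (b k)) (snd (b k)) = (if l = k then c l else 0)"
      using enum_pair(3)[OF assms] enum_pair(3)[of l] l by (auto simp: skew_unit_def prod_eq_iff)
  qed
  also have "\<dots> = c k" using assms by simp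
  finally show ?thesis .
qed

lemma lattice_emb_inj: "inj_on lattice_emb (carrier (int_power_group m))"
proof (rule inj_onI)
  fix c d assume cd: "c \<in> carrier (int_power_group m)" "d \<in> carrier (int_power_group m)" "lattice_emb c = lattice_emb d"
  then have "c k = d k" if "k < m" for k using translation_lattice_emb[OF that] by metis
  then show "c = d" using cd(1,2) by (intro PiE_ext[of c "{..<m}" _ d]) (auto simp: int_power_group_def)
qed

lemma pure_gen_in_lattice_emb_image:
  assumes "k < m"
  shows "pure_gen (fst (b k)) (snd (b k)) \<in> lattice_emb ` carrier (int_power_group m)"
proof
  let ?c = "\<lambda>l\<in>{..<m}. if k = l then 1 else 0 :: int"
  show "?c \<in> carrier (int_power_group m)" by (simp add: int_power_group_def)
  have "lattice_emb ?c = finprod pure_group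
      (\<lambda>l. if k = l then pure_gen (fst (b l)) (snd (b l)) else \<one>\<^bsub>pure_group\<^esub>) {..<m}"
    unfolding lattice_emb_def by (intro pure.finprod_cong') (auto simp: pure_gen_pure)
  also have "\<dots> = pure_gen (fst (b k)) (snd (b k))"
    using assms pure_gen_pure by (intro pure.finprod_singleton) auto
  finally show "pure_gen (fst (b k)) (snd (b k)) = lattice_emb ?c" by simp
qed

text \<open>
  The image is a subgroup containing \<open>pure_gen i j\<close> for \<open>i < j\<close>, hence also the inverses
  \<open>pure_gen j i\<close>, and all of these together generate the kernel.
\<close>

lemma lattice_emb_image: "lattice_emb ` carrier (int_power_group m) = kernel G (sym_group n) \<pi>"
proof
  show "lattice_emb ` carrier (int_power_group m) \<subseteq> kernel G (sym_group n) \<pi>"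
    using lattice_emb_closed unfolding pure_group_def by auto
  interpret \<iota>: group_hom "int_power_group m" G lattice_emb
    using lattice_emb_hom comm_group_int_power_group
    by (simp add: group_hom_def group_hom_axioms_def comm_group_def)
  have sub: "subgroup (lattice_emb ` carrier (int_power_group m)) G" by (rule \<iota>.img_is_subgroup)
  have asc: "pure_gen i j \<in> lattice_emb ` carrier (int_power_group m)" if "(i, j) \<in> index_pairs n" for i j
  proof -
    from that have "(i, j) \<in> b ` {..<m}" using bij_betw_imp_surj_on[OF enum] by simp
    then obtain k where "k < m" "b k = (i, j)" by fastforce
    then show ?thesis using pure_gen_in_lattice_emb_image[of k] by simp
  qed
  have "pure_gens \<subseteq> lattice_emb ` carrier (int_power_group m)"
  proof
    fix x assume "x \<in> pure_gens"
    then obtain i j where x: "x = pure_gen i j" "i \<in> {1..n}" "j \<in> {1..n}" "i \<noteq> j"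
      unfolding pure_gens_def by blast
    show "x \<in> lattice_emb ` carrier (int_power_group m)"
    proof (cases "i < j")
      case True
      then show ?thesis using asc[of i j] x by (simp add: index_pairs_def)
    next
      case False
      then have "pure_gen j i \<in> lattice_emb ` carrier (int_power_group m)"
        using asc[of j i] x by (simp add: index_pairs_def)
      then show ?thesis
        unfolding x(1) pure_gen_swap[OF x(3,2) x(4)[symmetric]] by (rule subgroup.m_inv_closed[OF sub])
    qed
  qed
  then have "generate G pure_gens \<subseteq> lattice_emb ` carrier (int_power_group m)"
    using sub by (rule generate_subgroup_incl)
  moreover have "kernel G (sym_group n) \<pi> \<subseteq> generate G pure_gens"
    unfolding kernel_def sym_group_one using kernel_in_generate_pure_gens by blast
  ultimately show "kernel G (sym_group n) \<pi> \<subseteq> lattice_emb ` carrier (int_power_group m)" by blast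
qed

lemma proj_split_short_exact: "split_short_exact (int_power_group m) G (sym_group n) lattice_emb \<pi>"
proof -
  have "\<pi> ` carrier G = carrier (sym_group n)"
  proof
    show "carrier (sym_group n) \<subseteq> \<pi> ` carrier G"
    proof
      fix p assume "p \<in> carrier (sym_group n)"
      then have "p permutes {1..n}" by (simp add: sym_group_carrier)
      then show "p \<in> \<pi> ` carrier G"
        using lift_closed[of p] proj_lift[of p] by (metis imageI)
    qed
  qed (use hom_in_carrier[OF proj_hom] in blast)
  then have "short_exact (int_power_group m) G (sym_group n) lattice_emb \<pi>"
    using comm_group_int_power_group[of m] is_group sym_group_is_group lattice_emb_hom lattice_emb_inj proj_hom lattice_emb_image
    by (simp add: short_exact_def mon_def epi_def comm_group_def)
  moreover have "\<forall>c\<in>carrier (sym_group n). \<pi> (lift c) = c"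
    by (simp add: sym_group_carrier proj_lift)
  ultimately show ?thesis unfolding split_short_exact_def using lift_hom by blast
qed

text \<open>
  Conjugation by \<open>x\<close> takes \<open>pure_gen i j\<close> to \<open>pure_gen (\<pi> x i) (\<pi> x j)\<close>, as the pure part of \<open>x\<close>
  commutes with the kernel. Equality of these elements forces equal translations, hence
  \<open>\<pi> x i = i\<close>; a partner \<open>j \<noteq> i\<close> exists because \<open>n \<ge> 2\<close>.
\<close>

lemma conjugation_faithful:
  assumes x: "x \<in> carrier G"
    and fixed: "\<And>y. \<lbrakk>y \<in> carrier G; \<pi> y = id\<rbrakk> \<Longrightarrow> x \<otimes> y \<otimes> inv x = y"
  shows "\<pi> x = id"
proof
  fix i
  have w: "\<pi> x permutes {1..n}" using proj_permutes[OF x] .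
  show "\<pi> x i = id i"
  proof (cases "i \<in> {1..n}")
    case False
    then show ?thesis using permutes_not_in[OF w] by simp
  next
    case True
    define j where "j = (if i = 1 then 2 else 1 :: nat)"
    have ij: "i \<in> {1..n}" "j \<in> {1..n}" "i \<noteq> j" using True two_le by (auto simp: j_def)
    then have wij: "\<pi> x i \<in> {1..n}" "\<pi> x j \<in> {1..n}" "\<pi> x i \<noteq> \<pi> x j"
      unfolding permutes_in_image[OF w] inj_eq[OF permutes_inj[OF w]] .
    define l where "l = pure_gen i j"
    define l' where "l' = pure_gen (\<pi> x i) (\<pi> x j)"
    define s where "s = lift (\<pi> x)"
    define z where "z = pure_part x"
    have cl: "l \<in> carrier G" "l' \<in> carrier G" "s \<in> carrier G" "z \<in> carrier G"
      using pure_gen_closed[OF ij] pure_gen_closed[OF wij] lift_closed[OF w] x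
      by (simp_all add: l_def l'_def s_def z_def pure_part_def)
    have zs: "z \<otimes> s = x" using x cl(3) by (simp add: z_def s_def pure_part_def m_assoc)
    have "\<pi> z = id"
      using x lift_closed[OF w] permutes_inv_o(1)[OF w]
      by (simp add: z_def pure_part_def proj_mult proj_inv proj_lift[OF w])
    then have zl': "z \<otimes> l' = l' \<otimes> z"
      using cl proj_pure_gen[OF wij] by (intro kernel_commute) (simp_all add: l'_def)
    have sl: "s \<otimes> l = l' \<otimes> s"
      unfolding l'_def conj_lift_pure_gen[OF w ij, symmetric] conj_lift_def
      using cl by (simp add: l_def s_def m_assoc)
    \<comment> \<open>With \<open>x = z \<otimes> s\<close>, moving \<open>l\<close> through \<open>s\<close> turns it into \<open>l'\<close>, which commutes with \<open>z\<close>.\<close>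
    have "l \<otimes> x = x \<otimes> l \<otimes> inv x \<otimes> x"
      using fixed[of l] cl(1) proj_pure_gen[OF ij] by (simp add: l_def)
    also have "\<dots> = z \<otimes> (s \<otimes> l)" using x cl by (simp add: m_assoc flip: zs)
    also have "\<dots> = z \<otimes> l' \<otimes> s" using cl by (simp add: sl m_assoc)
    also have "\<dots> = l' \<otimes> x" unfolding zl' using cl by (simp add: m_assoc zs)
    finally have "l = l'" using cl x by simp
    then have "skew_unit (\<pi> x i) (\<pi> x j) = skew_unit i j"
      using translation_pure_gen[OF ij] translation_pure_gen[OF wij] by (simp add: l_def l'_def)
    then have "skew_unit (\<pi> x i) (\<pi> x j) i j = skew_unit i j i j" by simp
    also have "\<dots> = 1" using ij(3) by (simp add: skew_unit_def)
    finally show ?thesis by (simp add: skew_unit_def of_bool_def split: if_splits)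
  qed
qed

end

section \<open>The virtual twin group and its quotient\<close>

lemma (in group) derived_subset_kernel:
  assumes "h \<in> hom G H" "group H" "P \<subseteq> carrier G"
    and "\<And>x y. \<lbrakk>x \<in> P; y \<in> P\<rbrakk> \<Longrightarrow> h (x \<otimes> y) = h (y \<otimes> x)"
  shows "derived G P \<subseteq> kernel G H h"
proof -
  interpret h: group_hom G H h
    using assms(1,2) by (simp add: group_hom_def group_hom_axioms_def)
  have "derived_set G P \<subseteq> kernel G H h"
  proof
    fix z assume "z \<in> derived_set G P"
    then obtain x y where xy: "x \<in> P" "y \<in> P" "z = x \<otimes> y \<otimes> inv x \<otimes> inv y" by blast
    then have cl: "x \<in> carrier G" "y \<in> carrier G" using assms(3) by auto
    have "z = (x \<otimes> y) \<otimes> inv (y \<otimes> x)" using cl by (simp add: xy(3) m_assoc inv_mult_group)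
    then have "h z = \<one>\<^bsub>H\<^esub>" using cl assms(4)[OF xy(1,2)] by simp
    then show "z \<in> kernel G H h" using cl by (simp add: kernel_def xy(3))
  qed
  then show ?thesis unfolding derived_def by (rule generate_subgroup_incl[OF _ h.subgroup_kernel])
qed

lemma (in group_hom) hom_eq_on_coset:
  assumes "N \<subseteq> kernel G H h" "x \<in> carrier G" "y \<in> N #> x"
  shows "h y = h x"
proof -
  obtain k where "k \<in> N" "y = k \<otimes> x" using assms(3) unfolding r_coset_def by blast
  then show ?thesis using assms(1,2) by (auto simp: kernel_def)
qed

definition vt_class :: "nat \<Rightarrow> vt_gen \<Rightarrow> vt_gen gword set" where
  "vt_class n s = word_class (VT_gens n) (VT_rels n) [(s, True)]"

lemma group_VT: "group (VT n)"
  unfolding VT_def by (rule group_presented_group)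

lemma vt_class_closed: "s \<in> VT_gens n \<Longrightarrow> vt_class n s \<in> carrier (VT n)"
  by (simp add: vt_class_def VT_def presented_group_def)

lemma pos_word_gwords: "set ss \<subseteq> S \<Longrightarrow> pos_word ss \<in> gwords S"
  by (auto simp: pos_word_def gwords_def)

lemma word_class_pos_word_Cons:
  assumes "s \<in> VT_gens n" "set ss \<subseteq> VT_gens n"
  shows "word_class (VT_gens n) (VT_rels n) (pos_word (s # ss)) =
    vt_class n s \<otimes>\<^bsub>VT n\<^esub> word_class (VT_gens n) (VT_rels n) (pos_word ss)"
  unfolding vt_class_def VT_def
  using assms pos_word_gwords[of ss "VT_gens n"]
  by (subst presented_mult) (simp_all add: pos_word_def)

lemma word_class_Nil: "word_class (VT_gens n) (VT_rels n) [] = \<one>\<^bsub>VT n\<^esub>"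
  by (simp add: VT_def presented_group_def)

lemma vt_product:
  assumes "set ss \<subseteq> VT_gens n"
  shows "word_class (VT_gens n) (VT_rels n) (pos_word ss) =
    foldr (\<lambda>s x. vt_class n s \<otimes>\<^bsub>VT n\<^esub> x) ss \<one>\<^bsub>VT n\<^esub>"
  using assms
proof (induction ss)
  case Nil
  then show ?case by (simp add: pos_word_def word_class_Nil)
next
  case (Cons s ss)
  then show ?case by (simp add: word_class_pos_word_Cons)
qed

text \<open>
  Right-nested products are the form in which the relations enter \<open>virtual_twin\<close> and
  \<open>adjacent_lifts\<close>.
\<close>

lemma vt_relation:
  assumes "(pos_word u, pos_word v) \<in> VT_rels n" "set u \<subseteq> VT_gens n" "set v \<subseteq> VT_gens n"
  shows "foldr (\<lambda>s x. vt_class n s \<otimes>\<^bsub>VT n\<^esub> x) u \<one>\<^bsub>VT n\<^esub> =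
    foldr (\<lambda>s x. vt_class n s \<otimes>\<^bsub>VT n\<^esub> x) v \<one>\<^bsub>VT n\<^esub>"
  using word_class_eq[OF word_eq.relation[OF assms(1), of "VT_gens n"]] assms(2,3)
  by (simp add: pos_word_gwords vt_product)

lemma VT_gens_iff:
  "Sig i \<in> VT_gens n \<longleftrightarrow> 1 \<le> i \<and> i < n" "Rho i \<in> VT_gens n \<longleftrightarrow> 1 \<le> i \<and> i < n"
  by (auto simp: VT_gens_def)

lemma VT_generated: "carrier (VT n) = generate (VT n) (vt_class n ` VT_gens n)"
proof
  interpret V: group "VT n" by (rule group_VT)
  show "generate (VT n) (vt_class n ` VT_gens n) \<subseteq> carrier (VT n)"
    by (intro V.generate_incl) (auto simp: vt_class_closed)
  have "word_class (VT_gens n) (VT_rels n) w \<in> generate (VT n) (vt_class n ` VT_gens n)"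
    if "w \<in> gwords (VT_gens n)" for w
    using that
  proof (induction w)
    case Nil
    then show ?case by (simp add: word_class_Nil generate.one)
  next
    case (Cons x w)
    obtain s e where x: "x = (s, e)" by (cases x)
    have s: "s \<in> VT_gens n" and w: "w \<in> gwords (VT_gens n)" using Cons.prems x by auto
    let ?c = "word_class (VT_gens n) (VT_rels n)"
    have letter: "?c [(s, e)] \<in> generate (VT n) (vt_class n ` VT_gens n)"
    proof (cases e)
      case True
      then show ?thesis using s by (auto simp: vt_class_def intro: generate.incl)
    next
      case False
      have "?c [(s, False)] \<otimes>\<^bsub>VT n\<^esub> vt_class n s = \<one>\<^bsub>VT n\<^esub>"
        unfolding vt_class_def VT_def
        using s word_class_eq[OF word_eq.cancel[of s "VT_gens n" "VT_rels n" False]]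
        by (subst presented_mult) (simp_all add: word_class_Nil[unfolded VT_def])
      moreover have "?c [(s, False)] \<in> carrier (VT n)"
        using s by (simp add: VT_def presented_group_def)
      ultimately have "inv\<^bsub>VT n\<^esub> vt_class n s = ?c [(s, False)]"
        using vt_class_closed[OF s] by (intro V.inv_equality)
      then show ?thesis using False s generate.inv[of "vt_class n s" "vt_class n ` VT_gens n" "VT n"] by simp
    qed
    have "?c (x # w) = ?c [(s, e)] \<otimes>\<^bsub>VT n\<^esub> ?c w"
      unfolding VT_def using s w x by (subst presented_mult) simp_all
    then show ?case using generate.eng[OF letter Cons.IH[OF w]] by simp
  qed
  then show "carrier (VT n) \<subseteq> generate (VT n) (vt_class n ` VT_gens n)"
    by (auto simp: VT_def presented_group_def)
qed

text \<open>
  The defining relations hold for these affine maps, so the action extends to the presented group. The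
  correction term of \<open>Sig i\<close> is skew-symmetric so that \<open>Sig i\<close> acts as an involution.
\<close>

fun affine_gen :: "vt_gen \<Rightarrow> (nat \<Rightarrow> nat \<Rightarrow> int) \<Rightarrow> nat \<Rightarrow> nat \<Rightarrow> int" where
  "affine_gen (Rho i) = (\<lambda>f p q. f (transpose i (Suc i) p) (transpose i (Suc i) q))"
| "affine_gen (Sig i) = (\<lambda>f p q. f (transpose i (Suc i) p) (transpose i (Suc i) q) + skew_unit i (Suc i) p q)"

lemma affine_gen_involution: "affine_gen s (affine_gen s f) = f"
  by (cases s; intro ext) (auto simp: skew_unit_def transpose_def)

lemma BijGroup_UNIV:
  "f \<in> carrier (BijGroup UNIV) \<longleftrightarrow> bij f"
  "\<one>\<^bsub>BijGroup UNIV\<^esub> = id"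
  "\<lbrakk>bij f; bij g\<rbrakk> \<Longrightarrow> f \<otimes>\<^bsub>BijGroup UNIV\<^esub> g = f \<circ> g"
  by (auto simp: BijGroup_def Bij_def extensional_def compose_def)

lemma affine_gen_bij: "bij (affine_gen s)"
  by (rule o_bij[of "affine_gen s"]) (auto simp: affine_gen_involution)

lemma word_value_affine_gen:
  "word_value (BijGroup UNIV) affine_gen (pos_word ss) = foldr affine_gen ss"
proof (induction ss)
  case Nil
  have "word_value (BijGroup UNIV) affine_gen (pos_word []) = id"
    by (simp add: word_value_def pos_word_def BijGroup_UNIV)
  then show ?case by (simp only: foldr.simps)
next
  case (Cons s ss)
  have "bij (foldr affine_gen ss)"
    by (induction ss) (simp_all only: foldr.simps bij_id bij_comp affine_gen_bij)
  moreover have "word_value (BijGroup UNIV) affine_gen (pos_word (s # ss)) =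
      affine_gen s \<otimes>\<^bsub>BijGroup UNIV\<^esub> word_value (BijGroup UNIV) affine_gen (pos_word ss)"
    by (simp add: word_value_def pos_word_def)
  ultimately show ?case
    by (simp only: Cons.IH foldr.simps BijGroup_UNIV(3) affine_gen_bij)
qed

lemma affine_gen_data: "presented_hom_data (BijGroup UNIV) (VT_gens n) (VT_rels n) affine_gen"
proof -
  interpret group "BijGroup (UNIV :: (nat \<Rightarrow> nat \<Rightarrow> int) set)" by (rule group_BijGroup)
  have disj: "i \<noteq> j \<and> i \<noteq> Suc j \<and> Suc i \<noteq> j" if "\<bar>int i - int j\<bar> \<ge> 2" for i j
    using that by auto
  have square: "word_value (BijGroup UNIV) affine_gen (pos_word [s, s]) =
      word_value (BijGroup UNIV) affine_gen []" for s
  proof -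
    have "word_value (BijGroup UNIV) affine_gen [] = id"
      by (simp add: word_value_def BijGroup_UNIV)
    then show ?thesis
      by (simp only: word_value_affine_gen) (simp add: fun_eq_iff affine_gen_involution)
  qed
  show ?thesis
  proof unfold_locales
    show "affine_gen s \<in> carrier (BijGroup UNIV)" for s
      by (simp add: BijGroup_UNIV affine_gen_bij)
    show "word_value (BijGroup UNIV) affine_gen u = word_value (BijGroup UNIV) affine_gen v"
      if "(u, v) \<in> VT_rels n" for u v
      using that
    proof cases
      case (sig_sq i)
      then show ?thesis by (simp only: square)
    next
      case (rho_sq i)
      then show ?thesis by (simp only: square)
    next
      case (sig_sig i j)
      then show ?thesis
        using disj[of i j]
        by (simp only: word_value_affine_gen) (auto simp: fun_eq_iff transpose_def skew_unit_def)
    next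
      case (rho_rho i j)
      then show ?thesis
        using disj[of i j]
        by (simp only: word_value_affine_gen) (auto simp: fun_eq_iff transpose_def)
    next
      case (rho_sig i j)
      then show ?thesis
        using disj[of i j]
        by (simp only: word_value_affine_gen) (auto simp: fun_eq_iff transpose_def skew_unit_def)
    next
      case (braid i)
      then show ?thesis
        by (simp only: word_value_affine_gen) (auto simp: fun_eq_iff transpose_def)
    next
      case (mixed i)
      then show ?thesis
        by (simp only: word_value_affine_gen) (auto simp: fun_eq_iff transpose_def skew_unit_def)
    qed
  qed
qed

definition VT_affine :: "nat \<Rightarrow> vt_gen gword set \<Rightarrow> (nat \<Rightarrow> nat \<Rightarrow> int) \<Rightarrow> nat \<Rightarrow> nat \<Rightarrow> int" where
  "VT_affine n = presented_hom (BijGroup UNIV) affine_gen"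

lemma VT_affine_class:
  assumes "s \<in> VT_gens n"
  shows "VT_affine n (vt_class n s) = affine_gen s"
proof -
  have "VT_affine n (vt_class n s) = word_value (BijGroup UNIV) affine_gen (pos_word [s])"
    unfolding VT_affine_def vt_class_def
    using presented_hom_data.presented_hom_class[OF affine_gen_data, of "[(s, True)]" n] assms
    by (simp add: pos_word_def)
  then show ?thesis by (simp only: word_value_affine_gen) simp
qed

lemma VT_virtual_twin:
  assumes "2 \<le> n"
  shows "virtual_twin (VT n) n (VT_proj n) (\<lambda>i. vt_class n (Rho i)) (\<lambda>i. vt_class n (Sig i)) (VT_affine n)"
proof -
  interpret V: group "VT n" by (rule group_VT)
  have cl: "vt_class n (Rho i) \<in> carrier (VT n)" "vt_class n (Sig i) \<in> carrier (VT n)"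
    if "1 \<le> i" "i < n" for i
    using that by (simp_all add: vt_class_closed VT_gens_iff)
  show ?thesis
  proof unfold_locales
    show "VT_proj n \<in> hom (VT n) (sym_group n)" by (rule VT_proj_hom)
    show "VT_affine n \<in> hom (VT n) (BijGroup UNIV)"
      unfolding VT_affine_def VT_def by (rule presented_hom_data.presented_hom_hom[OF affine_gen_data])
    show "2 \<le> n" by fact
    have "vt_class n ` VT_gens n = (\<lambda>i. vt_class n (Rho i)) ` {1..<n} \<union> (\<lambda>i. vt_class n (Sig i)) ` {1..<n}"
    proof -
      have "{1..n - 1} = {1..<n}" by auto
      then show ?thesis by (simp add: VT_gens_def image_Un image_image Un_commute)
    qed
    then show "carrier (VT n) =
        generate (VT n) ((\<lambda>i. vt_class n (Rho i)) ` {1..<n} \<union> (\<lambda>i. vt_class n (Sig i)) ` {1..<n})"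
      using VT_generated[of n] by simp
    fix i :: nat assume i: "1 \<le> i"
    {
      assume n: "i < n"
      show "vt_class n (Rho i) \<in> carrier (VT n)" "vt_class n (Sig i) \<in> carrier (VT n)"
        using cl[OF i n] by simp_all
      show "VT_proj n (vt_class n (Rho i)) = transpose i (Suc i)"
        "VT_proj n (vt_class n (Sig i)) = transpose i (Suc i)"
        using VT_proj_gen[of i n] i n by (simp_all add: vt_class_def)
      show "vt_class n (Rho i) \<otimes>\<^bsub>VT n\<^esub> vt_class n (Rho i) = \<one>\<^bsub>VT n\<^esub>"
        using vt_relation[of "[Rho i, Rho i]" "[]" n] VT_rels.rho_sq[of i n] i n cl[OF i n]
        by (simp add: VT_gens_iff pos_word_def)
      show "vt_class n (Sig i) \<otimes>\<^bsub>VT n\<^esub> vt_class n (Sig i) = \<one>\<^bsub>VT n\<^esub>"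
        using vt_relation[of "[Sig i, Sig i]" "[]" n] VT_rels.sig_sq[of i n] i n cl[OF i n]
        by (simp add: VT_gens_iff pos_word_def)
      show "VT_affine n (vt_class n (Rho i)) f p q = f (transpose i (Suc i) p) (transpose i (Suc i) q)"
        "VT_affine n (vt_class n (Sig i)) f p q =
          f (transpose i (Suc i) p) (transpose i (Suc i) q) + skew_unit i (Suc i) p q" for f p q
        using i n by (simp_all add: VT_affine_class VT_gens_iff)
    }
    {
      fix j assume j: "Suc i < j" "j < n"
      then have ij: "i \<in> {1..n - 1}" "j \<in> {1..n - 1}" "\<bar>int i - int j\<bar> \<ge> 2" "i < n" "1 \<le> j"
        using i by auto
      show "vt_class n (Rho i) \<otimes>\<^bsub>VT n\<^esub> vt_class n (Rho j) = vt_class n (Rho j) \<otimes>\<^bsub>VT n\<^esub> vt_class n (Rho i)"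
        using vt_relation[OF VT_rels.rho_rho[OF ij(1-3)]] i j ij(4,5) cl[of i] cl[of j]
        by (simp add: VT_gens_iff)
      show "vt_class n (Rho i) \<otimes>\<^bsub>VT n\<^esub> vt_class n (Sig j) = vt_class n (Sig j) \<otimes>\<^bsub>VT n\<^esub> vt_class n (Rho i)"
        using vt_relation[OF VT_rels.rho_sig[OF ij(1-3)]] i j ij(4,5) cl[of i] cl[of j]
        by (simp add: VT_gens_iff)
    }
    {
      assume n: "Suc i < n"
      then have i': "i \<in> {1..n - 2}" using i by auto
      show "vt_class n (Rho i) \<otimes>\<^bsub>VT n\<^esub> (vt_class n (Rho (Suc i)) \<otimes>\<^bsub>VT n\<^esub> vt_class n (Rho i)) =
          vt_class n (Rho (Suc i)) \<otimes>\<^bsub>VT n\<^esub> (vt_class n (Rho i) \<otimes>\<^bsub>VT n\<^esub> vt_class n (Rho (Suc i)))"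
        using vt_relation[OF VT_rels.braid[OF i']] i n cl[of i] cl[of "Suc i"]
        by (simp add: VT_gens_iff)
      show "vt_class n (Rho i) \<otimes>\<^bsub>VT n\<^esub> (vt_class n (Rho (Suc i)) \<otimes>\<^bsub>VT n\<^esub> vt_class n (Sig i)) =
          vt_class n (Sig (Suc i)) \<otimes>\<^bsub>VT n\<^esub> (vt_class n (Rho i) \<otimes>\<^bsub>VT n\<^esub> vt_class n (Rho (Suc i)))"
        using vt_relation[OF VT_rels.mixed[OF i']] i n cl[of i] cl[of "Suc i"]
        by (simp add: VT_gens_iff)
    }
  qed
qed

theorem theorem4p4:
  fixes n :: nat
  assumes "n \<ge> 2"
  shows "(\<exists>\<iota>. split_short_exact (int_power_group (n * (n - 1) div 2)) (VT_quot n) (sym_group n)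
            \<iota> (VT_proj_bar n)) \<and>
         crystallographic (VT_quot n)"
proof -
  let ?V = "VT n" and ?m = "n * (n - 1) div 2"
  let ?r = "\<lambda>i. vt_class n (Rho i)" and ?t = "\<lambda>i. vt_class n (Sig i)"
  interpret V: virtual_twin ?V n "VT_proj n" ?r ?t "VT_affine n"
    using assms by (rule VT_virtual_twin)
  define D where "D = derived ?V (PVT n)"
  have PVT_iff: "x \<in> PVT n \<longleftrightarrow> x \<in> carrier ?V \<and> VT_proj n x = id" for x
    by (simp add: PVT_def kernel_def sym_group_one)
  have D: "D \<lhd> ?V"
    unfolding D_def PVT_def
    by (intro V.derived_is_normal group_hom.normal_kernel[OF V.proj_group_hom])
  interpret D: normal D ?V by (rule D)
  interpret aff: group_hom ?V "BijGroup UNIV" "VT_affine n"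
    using V.affine_hom by (simp add: group_hom_def group_hom_axioms_def V.is_group group_BijGroup)
  interpret proj: group_hom ?V "sym_group n" "VT_proj n" by (rule V.proj_group_hom)
  have D_proj: "D \<subseteq> kernel ?V (sym_group n) (VT_proj n)"
    unfolding D_def
    by (rule V.derived_subset_kernel[OF V.proj_hom sym_group_is_group])
      (auto simp: PVT_iff V.proj_mult)
  \<comment> \<open>Both \<open>VT_proj\<close> and the affine action are trivial on the commutator subgroup and descend.\<close>
  have D_aff: "D \<subseteq> kernel ?V (BijGroup UNIV) (VT_affine n)"
    unfolding D_def
  proof (rule V.derived_subset_kernel[OF V.affine_hom group_BijGroup])
    show "PVT n \<subseteq> carrier ?V" using PVT_iff by blast
    show "VT_affine n (x \<otimes>\<^bsub>?V\<^esub> y) = VT_affine n (y \<otimes>\<^bsub>?V\<^esub> x)" if "x \<in> PVT n" "y \<in> PVT n" for x y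
      using that unfolding PVT_iff by (intro V.affine_kernel_commute) simp_all
  qed
  have quot: "VT_quot n = ?V Mod D" by (simp add: VT_quot_def D_def)
  have bar: "VT_proj_bar n (D #>\<^bsub>?V\<^esub> x) = VT_proj n x" if x: "x \<in> carrier ?V" for x
  proof -
    have "x \<in> D #>\<^bsub>?V\<^esub> x" using x D.subgroup_axioms by (rule V.rcos_self)
    then have "VT_proj n ` (D #>\<^bsub>?V\<^esub> x) = {VT_proj n x}"
      using proj.hom_eq_on_coset[OF D_proj x] by blast
    then show ?thesis by (simp add: VT_proj_bar_def)
  qed
  have bar_hom: "VT_proj_bar n \<in> hom (?V Mod D) (sym_group n)"
  proof (rule homI)
    fix X assume "X \<in> carrier (?V Mod D)"
    then obtain x where x: "x \<in> carrier ?V" "X = D #>\<^bsub>?V\<^esub> x" by (auto simp: carrier_FactGroup)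
    then show "VT_proj_bar n X \<in> carrier (sym_group n)" by (simp add: bar)
    fix Y assume "Y \<in> carrier (?V Mod D)"
    then obtain y where y: "y \<in> carrier ?V" "Y = D #>\<^bsub>?V\<^esub> y" by (auto simp: carrier_FactGroup)
    show "VT_proj_bar n (X \<otimes>\<^bsub>?V Mod D\<^esub> Y) = VT_proj_bar n X \<otimes>\<^bsub>sym_group n\<^esub> VT_proj_bar n Y"
      using x y by (simp add: D.rcos_sum bar)
  qed
  have aff_wd: "VT_affine n x = VT_affine n y"
    if "x \<in> carrier ?V" "y \<in> carrier ?V" "D #>\<^bsub>?V\<^esub> x = D #>\<^bsub>?V\<^esub> y" for x y
  proof -
    have "x \<in> D #>\<^bsub>?V\<^esub> y" using V.rcos_self[OF that(1) D.subgroup_axioms] that(3) by simp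
    then show ?thesis using aff.hom_eq_on_coset[OF D_aff that(2)] by simp
  qed
  obtain aff' where aff': "aff' \<in> hom (?V Mod D) (BijGroup UNIV)"
    "\<And>x. x \<in> carrier ?V \<Longrightarrow> aff' (D #>\<^bsub>?V\<^esub> x) = VT_affine n x"
    using FactGroup_universal[OF V.affine_hom D aff_wd] by blast
  interpret Q: virtual_twin "VT_quot n" n "VT_proj_bar n" "\<lambda>i. D #>\<^bsub>?V\<^esub> ?r i" "\<lambda>i. D #>\<^bsub>?V\<^esub> ?t i" aff'
    unfolding quot using D bar_hom bar aff' by (rule V.quotient_virtual_twin)
  have commute: "X \<otimes>\<^bsub>VT_quot n\<^esub> Y = Y \<otimes>\<^bsub>VT_quot n\<^esub> X"
    if XY: "X \<in> carrier (VT_quot n)" "Y \<in> carrier (VT_quot n)" "VT_proj_bar n X = id" "VT_proj_bar n Y = id" for X Y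
  proof -
    obtain x y where x: "x \<in> carrier ?V" "X = D #>\<^bsub>?V\<^esub> x" and y: "y \<in> carrier ?V" "Y = D #>\<^bsub>?V\<^esub> y"
      using XY(1,2) unfolding quot carrier_FactGroup by blast
    then have "x \<in> PVT n" "y \<in> PVT n" using XY(3,4) by (simp_all add: PVT_iff bar)
    then have comm: "x \<otimes>\<^bsub>?V\<^esub> y \<otimes>\<^bsub>?V\<^esub> inv\<^bsub>?V\<^esub> x \<otimes>\<^bsub>?V\<^esub> inv\<^bsub>?V\<^esub> y \<in> D"
      unfolding D_def derived_def by (intro generate.incl) blast
    have "x \<otimes>\<^bsub>?V\<^esub> y \<in> D #>\<^bsub>?V\<^esub> (y \<otimes>\<^bsub>?V\<^esub> x)"
    proof -
      have "x \<otimes>\<^bsub>?V\<^esub> y \<otimes>\<^bsub>?V\<^esub> inv\<^bsub>?V\<^esub> x \<otimes>\<^bsub>?V\<^esub> inv\<^bsub>?V\<^esub> y \<otimes>\<^bsub>?V\<^esub> (y \<otimes>\<^bsub>?V\<^esub> x) =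
          x \<otimes>\<^bsub>?V\<^esub> y \<otimes>\<^bsub>?V\<^esub> inv\<^bsub>?V\<^esub> x \<otimes>\<^bsub>?V\<^esub> (inv\<^bsub>?V\<^esub> y \<otimes>\<^bsub>?V\<^esub> y) \<otimes>\<^bsub>?V\<^esub> x"
        using x(1) y(1) by (simp only: V.m_assoc V.m_closed V.inv_closed)
      also have "\<dots> = x \<otimes>\<^bsub>?V\<^esub> y" using x(1) y(1) by (simp add: V.m_assoc)
      finally show ?thesis
        using V.rcosI[OF comm D.subset, of "y \<otimes>\<^bsub>?V\<^esub> x"] x(1) y(1) by simp
    qed
    then have "D #>\<^bsub>?V\<^esub> (y \<otimes>\<^bsub>?V\<^esub> x) = D #>\<^bsub>?V\<^esub> (x \<otimes>\<^bsub>?V\<^esub> y)"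
      using x(1) y(1) D.subgroup_axioms by (intro V.repr_independence) simp_all
    then show ?thesis using x y by (simp add: quot D.rcos_sum)
  qed
  obtain b where b: "bij_betw b {..<?m} (index_pairs n)"
    using ex_bij_betw_nat_finite[OF card_index_pairs(1)[of n]]
    by (auto simp: card_index_pairs(2) atLeast0LessThan)
  interpret Q: virtual_twin_abelian "VT_quot n" n "VT_proj_bar n" "\<lambda>i. D #>\<^bsub>?V\<^esub> ?r i" "\<lambda>i. D #>\<^bsub>?V\<^esub> ?t i" aff' b ?m
    using commute b by unfold_locales
  note split = Q.proj_split_short_exact
  have "crystallographic (VT_quot n)"
  proof (rule crystallographicI)
    show ses: "short_exact (int_power_group ?m) (VT_quot n) (sym_group n) Q.lattice_emb (VT_proj_bar n)"
      using split by (simp add: split_short_exact_def)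
    show "finite (carrier (sym_group n))"
      by (simp add: sym_group_def finite_permutations)
    fix X assume X: "X \<in> carrier (VT_quot n)"
      and fixed: "\<And>a. a \<in> carrier (int_power_group ?m) \<Longrightarrow>
        X \<otimes>\<^bsub>VT_quot n\<^esub> Q.lattice_emb a \<otimes>\<^bsub>VT_quot n\<^esub> inv\<^bsub>VT_quot n\<^esub> X = Q.lattice_emb a"
    have "VT_proj_bar n X = id"
    proof (rule Q.conjugation_faithful[OF X])
      fix Y assume "Y \<in> carrier (VT_quot n)" "VT_proj_bar n Y = id"
      then have "Y \<in> Q.lattice_emb ` carrier (int_power_group ?m)"
        unfolding Q.lattice_emb_image by (simp add: kernel_def sym_group_one)
      then show "X \<otimes>\<^bsub>VT_quot n\<^esub> Y \<otimes>\<^bsub>VT_quot n\<^esub> inv\<^bsub>VT_quot n\<^esub> X = Y" using fixed by blast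
    qed
    then show "VT_proj_bar n X = \<one>\<^bsub>sym_group n\<^esub>" by (simp add: sym_group_one)
  qed
  then show ?thesis using split by blast
qed

end
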